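(* Let $f=(f_t)_{t\in\mathcal T}\in H^{|\mathcal T|}$ and $\alpha\in[0,\infty)$. If $\alpha=0$, assume that there exists $\lambda\in\mathcal M_+(\Lambda)$ with $\mathrm{Ob}_t\mathrm{Mv}^d_t\lambda=f_t$ for all $t\in\mathcal T$. Then the problem $$(\mathrm P_\alpha(f))\qquad\min_{\gamma\in\mathcal M_+(\Theta\times\Gamma),\ u\in\mathcal M_+(\Omega)^\Sigma}\|\gamma\|_{\mathcal M}+\frac1{2\alpha}\sum_{t\in\mathcal T}\|\mathrm{Ob}_tu_t-f_t\|_H^2\quad\text{s.t. }\ \overline{\mathrm{Mv}}_t\gamma=\mathrm{Rd}\,u_t\ \text{ for all }t\in\Sigma$$ has a solution. Moreover, for $\alpha>0$ the solutions are stable in the following sense: let $f^1,f^2,\ldots\in H^{|\mathcal T|}$ be a sequence with $f^n_t\to f_t$ in $H$ for all $t\in\mathcal T$ as $n\to\infty$, and let $(u^n,\gamma^n)$ be a corresponding sequence of solutions to $\mathrm P_\alpha(f^n)$. Then: (i) the sequence $(u^n,\gamma^n)$ has a $\mathcal T$-cluster point; (ii) any $\mathcal T$-cluster point $(u,\gamma)$ of $(u^n,\gamma^n)$ is a solution of $\mathrm P_\alpha(f)$; (iii) if the solution $(u,\gamma)$ to $\mathrm P_\alpha(f)$ is unique, then the entire sequences $u^n_t$ and $\gamma^n$ converge weakly-$*$ to $u_t$ and $\gamma$, respectively, for all $t\in\Sigma$.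
   Context: $\mathcal M(X)$ and $\mathcal M_+(X)$ denote the finite signed and the finite nonnegative Radon measures on $X$, $\|\cdot\|_{\mathcal M}$ the total variation norm, $g_\#\nu$ the pushforward. $d\in\mathbb N$; $\Omega\subset\mathbb R^d$, $\Sigma\subset\mathbb R$ and $\Theta\subset S^{d-1}$ are compact; $\emptyset\ne\mathcal T\subset\Sigma$ is finite; $\mathcal H_\Theta$ is a Borel probability measure on $\Theta$ with $\operatorname{supp}\mathcal H_\Theta=\Theta$. $\Lambda=\{(x,v)\in\mathbb R^d\times\mathbb R^d: x+tv\in\Omega\ \forall t\in\Sigma\}$, $\Gamma=\{(\theta\cdot x,\theta\cdot v):(x,v)\in\Lambda,\theta\in\Theta\}\subset\mathbb R^2$, $\Xi=\{\theta\cdot x:x\in\Omega,\theta\in\Theta\}\subset\mathbb R$; all are compact. Operators: $\mathrm{Rd}_\theta\nu=[x\mapsto\theta\cdot x]_\#\nu$ and $\mathrm{Rd}\,\nu=\mathcal H_\Theta\otimes_\theta\mathrm{Rd}_\theta\nu\in\mathcal M(\Theta\times\Xi)$, i.e. $\mathrm{Rd}\,\nu(A\times B)=\int_A\mathrm{Rd}_\theta\nu(B)\,\mathrm d\mathcal H_\Theta(\theta)$, for $\nu\in\mathcal M(\Omega)$; $\mathrm{Mv}^d_t\lambda=[(x,v)\mapsto x+tv]_\#\lambda$ for $\lambda\in\mathcal M(\mathbb R^d\times\mathbb R^d)$; $\overline{\mathrm{Mv}}_t\gamma=[(\theta,x,v)\mapsto(\theta,x+tv)]_\#\gamma$ for $\gamma\in\mathcal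 M(\Theta\times\mathbb R^2)$. $H$ is a Hilbert space and, for $t\in\mathcal T$, $\mathrm{Ob}_t:\mathcal M(\Omega)\to H$ is the dual of a bounded linear operator $\mathrm{Ob}_t^*:H\to C(\Omega)$ (so it is weak-$*$-to-weak continuous). For $\alpha=0$ the data term in $\mathrm P_\alpha(f)$ is interpreted as the constraint $\mathrm{Ob}_tu_t=f_t$ for all $t\in\mathcal T$. $\mathcal M_+(\Omega)^\Sigma$ is the set of families $(u_t)_{t\in\Sigma}$ in $\mathcal M_+(\Omega)$. $(u,\gamma)\in\mathcal M_+(\Omega)^\Sigma\times\mathcal M_+(\Theta\times\Gamma)$ is a $\mathcal T$-cluster point of a sequence $(u^n,\gamma^n)$ if there is a subsequence $n_1,n_2,\ldots$ with $u_t^{n_k}\overset{*}\rightharpoonup u_t$ for all $t\in\mathcal T$ and $\gamma^{n_k}\overset{*}\rightharpoonup\gamma$ as $k\to\infty$, and such that for all $t\in\Sigma\setminus\mathcal T$ the measure $u_t$ is a cluster point of $u_t^{n_1},u_t^{n_2},\ldots$ with respect to weak-$*$ convergence (i.e. the limit of a further subsequence, which may depend on $t$). *)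

theory Defs
  imports "HOL-Probability.Probability"
begin

section \<open>Nonnegative Radon measures on a set\<close>

text \<open>Every measure entering the statement is nonnegative, so the elements of the space of finite
  nonnegative Radon measures on \<open>X\<close> are measures on the Borel sets of \<open>X\<close>.\<close>

definition radon_measures :: "'a::topological_space set \<Rightarrow> 'a measure set" where
  "radon_measures X = {M. sets M = sets (restrict_space borel X) \<and> finite_measure M \<and>
     (\<forall>A\<in>sets M. emeasure M A = (SUP K\<in>{K. K \<subseteq> A \<and> compact K}. emeasure M K))}"

definition total_variation :: "'a measure \<Rightarrow> real" where
  "total_variation M =
     (SUP P\<in>{P. finite P \<and> disjoint P \<and> P \<subseteq> sets M}. \<Sum>A\<in>P. \<bar>measure M A\<bar>)"

definition pushforward :: "'b::topological_space set \<Rightarrow> ('a \<Rightarrow> 'b) \<Rightarrow> 'a measure \<Rightarrow> 'b measure" where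
  "pushforward Y g M = distr M (restrict_space borel Y) g"

text \<open>Used for compact \<open>X\<close> only, where the predual is the space of all continuous functions.\<close>

definition weak_star_tendsto ::
    "'a::topological_space set \<Rightarrow> (nat \<Rightarrow> 'a measure) \<Rightarrow> 'a measure \<Rightarrow> bool" where
  "weak_star_tendsto X Ms M \<longleftrightarrow>
     (\<forall>\<phi>::'a \<Rightarrow> real. continuous_on X \<phi> \<longrightarrow>
        (\<lambda>n. integral\<^sup>L (Ms n) \<phi>) \<longlonglongrightarrow> integral\<^sup>L M \<phi>)"

definition measure_support :: "'a::topological_space measure \<Rightarrow> 'a set" where
  "measure_support M =
     {x \<in> space M. \<forall>U. open U \<longrightarrow> x \<in> U \<longrightarrow> emeasure M (U \<inter> space M) > 0}"


section \<open>Phase space and operators\<close>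

text \<open>Below, \<open>S\<close> is the set of all times, and \<open>T\<close> the finite set of measurement times.\<close>

definition Lam :: "(real^'d) set \<Rightarrow> real set \<Rightarrow> ((real^'d) \<times> (real^'d)) set" where
  "Lam \<Omega> S = {(x, v). \<forall>t\<in>S. x + t *\<^sub>R v \<in> \<Omega>}"

definition Gam :: "(real^'d) set \<Rightarrow> real set \<Rightarrow> (real^'d) set \<Rightarrow> (real \<times> real) set" where
  "Gam \<Omega> S \<Theta> = {(\<theta> \<bullet> x, \<theta> \<bullet> v) | x v \<theta>. (x, v) \<in> Lam \<Omega> S \<and> \<theta> \<in> \<Theta>}"

definition Xi :: "(real^'d) set \<Rightarrow> (real^'d) set \<Rightarrow> real set" where
  "Xi \<Omega> \<Theta> = {\<theta> \<bullet> x | x \<theta>. x \<in> \<Omega> \<and> \<theta> \<in> \<Theta>}"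

definition Rd_at :: "real^'d \<Rightarrow> (real^'d) measure \<Rightarrow> real measure" where
  "Rd_at \<theta> \<nu> = pushforward UNIV (\<lambda>x. \<theta> \<bullet> x) \<nu>"

text \<open>The measure \<open>\<H> \<otimes>\<^sub>\<theta> Rd_at \<theta> \<nu>\<close> on \<open>\<Theta> \<times> Xi \<Omega> \<Theta>\<close>, given on an arbitrary Borel set by
  integrating the masses of its sections; see \<open>emeasure_Rd_Times\<close> for rectangles.\<close>

definition Rd :: "(real^'d) set \<Rightarrow> (real^'d) set \<Rightarrow> (real^'d) measure \<Rightarrow> (real^'d) measure
    \<Rightarrow> ((real^'d) \<times> real) measure" where
  "Rd \<Omega> \<Theta> \<H> \<nu> =
     measure_of (\<Theta> \<times> Xi \<Omega> \<Theta>) (sets (restrict_space borel (\<Theta> \<times> Xi \<Omega> \<Theta>)))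
       (\<lambda>E. \<integral>\<^sup>+\<theta>. emeasure (Rd_at \<theta> \<nu>) (Pair \<theta> -` E) \<partial>\<H>)"

definition Mv :: "(real^'d) set \<Rightarrow> real \<Rightarrow> ((real^'d) \<times> (real^'d)) measure \<Rightarrow> (real^'d) measure" where
  "Mv \<Omega> t = pushforward \<Omega> (\<lambda>(x, v). x + t *\<^sub>R v)"

text \<open>For \<open>t \<in> S\<close>, the map below sends \<open>\<Theta> \<times> Gam \<Omega> S \<Theta>\<close> into \<open>\<Theta> \<times> Xi \<Omega> \<Theta>\<close>.\<close>

definition Mv_bar :: "(real^'d) set \<Rightarrow> (real^'d) set \<Rightarrow> real
    \<Rightarrow> ((real^'d) \<times> (real \<times> real)) measure \<Rightarrow> ((real^'d) \<times> real) measure" where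
  "Mv_bar \<Omega> \<Theta> t = pushforward (\<Theta> \<times> Xi \<Omega> \<Theta>) (\<lambda>(\<theta>, x, v). (\<theta>, x + t * v))"

text \<open>\<open>P\<close> represents a bounded linear operator into the continuous functions on \<open>X\<close> with the
  supremum norm; the values of \<open>P h\<close> outside \<open>X\<close> are irrelevant.\<close>

definition bounded_linear_into_C ::
    "'a::topological_space set \<Rightarrow> ('h::real_normed_vector \<Rightarrow> 'a \<Rightarrow> real) \<Rightarrow> bool" where
  "bounded_linear_into_C X P \<longleftrightarrow>
     (\<forall>h. continuous_on X (P h)) \<and>
     (\<forall>h k. \<forall>x\<in>X. P (h + k) x = P h x + P k x) \<and>
     (\<forall>c h. \<forall>x\<in>X. P (c *\<^sub>R h) x = c * P h x) \<and>
     (\<exists>C. \<forall>h. \<forall>x\<in>X. \<bar>P h x\<bar> \<le> C * norm h)"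

text \<open>\<open>Q\<close> is the restriction to nonnegative measures of the dual operator of \<open>P\<close> (the dual of the
  Hilbert space being identified with the space itself). This determines \<open>Q\<close> on nonnegative
  measures, and hence, by linearity, the dual operator on all signed measures.\<close>

definition is_dual_operator ::
    "'a::topological_space set \<Rightarrow> ('h::real_inner \<Rightarrow> 'a \<Rightarrow> real) \<Rightarrow> ('a measure \<Rightarrow> 'h) \<Rightarrow> bool" where
  "is_dual_operator X P Q \<longleftrightarrow>
     (\<forall>\<nu>\<in>radon_measures X. \<forall>h. Q \<nu> \<bullet> h = integral\<^sup>L \<nu> (P h))"


section \<open>The optimization problem\<close>

text \<open>Families indexed by \<open>S\<close> are extensional functions, so that equality of two such families is
  equality at all times in \<open>S\<close>. In the case \<open>\<alpha> = 0\<close> the data term is a constraint.\<close>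

definition feasible :: "(real^'d) set \<Rightarrow> real set \<Rightarrow> (real^'d) set \<Rightarrow> real set \<Rightarrow> (real^'d) measure
    \<Rightarrow> (real \<Rightarrow> (real^'d) measure \<Rightarrow> 'h::real_inner) \<Rightarrow> real \<Rightarrow> (real \<Rightarrow> 'h)
    \<Rightarrow> (real \<Rightarrow> (real^'d) measure) \<times> ((real^'d) \<times> (real \<times> real)) measure \<Rightarrow> bool" where
  "feasible \<Omega> S \<Theta> T \<H> Ob \<alpha> f = (\<lambda>(u, \<gamma>).
     u \<in> S \<rightarrow>\<^sub>E radon_measures \<Omega> \<and>
     \<gamma> \<in> radon_measures (\<Theta> \<times> Gam \<Omega> S \<Theta>) \<and>
     (\<forall>t\<in>S. Mv_bar \<Omega> \<Theta> t \<gamma> = Rd \<Omega> \<Theta> \<H> (u t)) \<and>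
     (\<alpha> = 0 \<longrightarrow> (\<forall>t\<in>T. Ob t (u t) = f t)))"

definition objective :: "real set \<Rightarrow> (real \<Rightarrow> (real^'d) measure \<Rightarrow> 'h::real_inner)
    \<Rightarrow> real \<Rightarrow> (real \<Rightarrow> 'h)
    \<Rightarrow> (real \<Rightarrow> (real^'d) measure) \<times> ((real^'d) \<times> (real \<times> real)) measure \<Rightarrow> real" where
  "objective T Ob \<alpha> f = (\<lambda>(u, \<gamma>).
     total_variation \<gamma> +
     (if \<alpha> = 0 then 0 else 1 / (2 * \<alpha>) * (\<Sum>t\<in>T. (norm (Ob t (u t) - f t))\<^sup>2)))"

definition is_solution :: "(real^'d) set \<Rightarrow> real set \<Rightarrow> (real^'d) set \<Rightarrow> real set \<Rightarrow> (real^'d) measure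
    \<Rightarrow> (real \<Rightarrow> (real^'d) measure \<Rightarrow> 'h::real_inner) \<Rightarrow> real \<Rightarrow> (real \<Rightarrow> 'h)
    \<Rightarrow> (real \<Rightarrow> (real^'d) measure) \<times> ((real^'d) \<times> (real \<times> real)) measure \<Rightarrow> bool" where
  "is_solution \<Omega> S \<Theta> T \<H> Ob \<alpha> f =
     is_arg_min (objective T Ob \<alpha> f) (feasible \<Omega> S \<Theta> T \<H> Ob \<alpha> f)"

definition cluster_point :: "(real^'d) set \<Rightarrow> real set \<Rightarrow> (real^'d) set \<Rightarrow> real set
    \<Rightarrow> (nat \<Rightarrow> real \<Rightarrow> (real^'d) measure) \<Rightarrow> (nat \<Rightarrow> ((real^'d) \<times> (real \<times> real)) measure)
    \<Rightarrow> (real \<Rightarrow> (real^'d) measure) \<times> ((real^'d) \<times> (real \<times> real)) measure \<Rightarrow> bool" where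
  "cluster_point \<Omega> S \<Theta> T us \<gamma>s = (\<lambda>(u, \<gamma>).
     u \<in> S \<rightarrow>\<^sub>E radon_measures \<Omega> \<and>
     \<gamma> \<in> radon_measures (\<Theta> \<times> Gam \<Omega> S \<Theta>) \<and>
     (\<exists>r::nat \<Rightarrow> nat. strict_mono r \<and>
        (\<forall>t\<in>T. weak_star_tendsto \<Omega> (\<lambda>k. us (r k) t) (u t)) \<and>
        weak_star_tendsto (\<Theta> \<times> Gam \<Omega> S \<Theta>) (\<lambda>k. \<gamma>s (r k)) \<gamma> \<and>
        (\<forall>t\<in>S - T. \<exists>s::nat \<Rightarrow> nat. strict_mono s \<and>
           weak_star_tendsto \<Omega> (\<lambda>k. us (r (s k)) t) (u t))))"


section \<open>Consistency of the definitions\<close>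

lemma space_radon_measures: "M \<in> radon_measures X \<Longrightarrow> space M = X"
  by (auto simp: radon_measures_def space_restrict_space dest: sets_eq_imp_space_eq)

lemma total_variation_eq_mass:
  assumes "finite_measure M"
  shows "total_variation M = measure M (space M)"
proof -
  interpret finite_measure M by fact
  let ?S = "{P. finite P \<and> disjoint P \<and> P \<subseteq> sets M}"
  have *: "(\<Sum>A\<in>P. \<bar>measure M A\<bar>) \<le> measure M (space M)" if "P \<in> ?S" for P
  proof -
    have "(\<Sum>A\<in>P. \<bar>measure M A\<bar>) = measure M (\<Union>A\<in>P. A)"
      using that by (subst finite_measure_finite_Union)
        (auto simp: disjoint_def disjoint_family_on_def)
    also have "\<dots> \<le> measure M (space M)"
      by (rule bounded_measure)
    finally show ?thesis .
  qed
  have "{space M} \<in> ?S" "(\<Sum>A\<in>{space M}. \<bar>measure M A\<bar>) = measure M (space M)"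
    by (simp_all add: disjoint_def)
  then have "measure M (space M) \<in> (\<lambda>P. \<Sum>A\<in>P. \<bar>measure M A\<bar>) ` ?S"
    by (metis (no_types, lifting) image_eqI)
  then show ?thesis
    unfolding total_variation_def
    by (rule cSup_eq_maximum) (use * in blast)
qed

lemma radon_measures_compact:
  fixes X :: "'a::polish_space set"
  assumes "compact X"
  shows "M \<in> radon_measures X \<longleftrightarrow> sets M = sets (restrict_space borel X) \<and> finite_measure M"
proof -
  have "emeasure M A = (SUP K\<in>{K. K \<subseteq> A \<and> compact K}. emeasure M K)"
    if M: "sets M = sets (restrict_space borel X)" "finite_measure M" and A: "A \<in> sets M" for A
  proof -
    interpret finite_measure M by fact
    have X: "X \<in> sets borel"
      using assms by (simp add: borel_closed compact_imp_closed)
    have sp: "space M = X"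
      using M(1) by (auto simp: space_restrict_space dest: sets_eq_imp_space_eq)
    have id: "(\<lambda>x. x) \<in> measurable M borel"
      using M(1) by (simp cong: measurable_cong_sets add: measurable_restrict_space1)
    let ?N = "distr M borel (\<lambda>x. x)"
    have AX: "A \<in> sets borel" "A \<subseteq> X"
      using A M(1) X by (auto simp: sets_restrict_space_iff)
    have eq: "emeasure ?N B = emeasure M B" if "B \<in> sets borel" "B \<subseteq> X" for B
      using that id by (simp add: emeasure_distr sp Int_absorb2)
    have "emeasure ?N (space ?N) \<noteq> \<infinity>"
      using id by (simp add: emeasure_distr sp)
    then have "emeasure ?N A = (SUP K\<in>{K. K \<subseteq> A \<and> compact K}. emeasure ?N K)"
      using AX by (intro inner_regular) auto
    also have "\<dots> = (SUP K\<in>{K. K \<subseteq> A \<and> compact K}. emeasure M K)"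
      using AX by (intro SUP_cong refl eq) (auto simp: borel_compact)
    finally show ?thesis using AX eq by simp
  qed
  then show ?thesis by (auto simp: radon_measures_def)
qed

lemma emeasure_Rd:
  fixes \<Omega> \<Theta> :: "(real^'d) set"
  assumes \<H>: "sets \<H> = sets (restrict_space borel \<Theta>)"
    and \<nu>: "\<nu> \<in> radon_measures \<Omega>"
    and E: "E \<in> sets (restrict_space borel (\<Theta> \<times> Xi \<Omega> \<Theta>))"
    and c: "compact \<Omega>" "compact \<Theta>"
  shows "emeasure (Rd \<Omega> \<Theta> \<H> \<nu>) E = (\<integral>\<^sup>+\<theta>. emeasure (Rd_at \<theta> \<nu>) (Pair \<theta> -` E) \<partial>\<H>)"
proof -
  let ?R = "restrict_space borel (\<Theta> \<times> Xi \<Omega> \<Theta>) :: ((real^'d) \<times> real) measure"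
  let ?g = "\<lambda>(\<theta>, x). (\<theta>, \<theta> \<bullet> x) :: (real^'d) \<times> real"
  interpret \<nu>: finite_measure \<nu> using \<nu> by (simp add: radon_measures_def)
  have sp: "space \<H> = \<Theta>" "space \<nu> = \<Omega>"
    using \<H> \<nu> by (auto simp: space_restrict_space space_radon_measures dest: sets_eq_imp_space_eq)
  have s\<nu>: "sets \<nu> = sets (restrict_space borel \<Omega>)"
    using \<nu> by (simp add: radon_measures_def)
  have m1: "fst \<in> measurable (\<H> \<Otimes>\<^sub>M \<nu>) borel" "snd \<in> measurable (\<H> \<Otimes>\<^sub>M \<nu>) borel"
    using measurable_fst[of \<H> \<nu>] measurable_snd[of \<H> \<nu>] \<H> s\<nu>
    by (auto simp: measurable_restrict_space2_iff cong: measurable_cong_sets)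
  have "(\<lambda>p. (fst p, fst p \<bullet> snd p)) \<in> measurable (\<H> \<Otimes>\<^sub>M \<nu>) borel"
    using m1 by (intro borel_measurable_Pair borel_measurable_inner)
  then have g: "?g \<in> measurable (\<H> \<Otimes>\<^sub>M \<nu>) ?R"
    by (auto simp: measurable_restrict_space2_iff space_pair_measure sp Xi_def case_prod_beta)
  have "compact (Xi \<Omega> \<Theta>)"
  proof -
    have "compact ((\<lambda>(x, \<theta>). \<theta> \<bullet> x) ` (\<Omega> \<times> \<Theta>))"
      using c by (intro compact_continuous_image compact_Times)
        (auto simp: case_prod_beta intro!: continuous_intros)
    moreover have "Xi \<Omega> \<Theta> = (\<lambda>(x, \<theta>). \<theta> \<bullet> x) ` (\<Omega> \<times> \<Theta>)"
      by (auto simp: Xi_def)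
    ultimately show ?thesis by simp
  qed
  then have B: "\<Theta> \<times> Xi \<Omega> \<Theta> \<in> sets borel"
    using c by (intro borel_compact compact_Times)
  have sec: "emeasure (Rd_at \<theta> \<nu>) (Pair \<theta> -` F) =
      emeasure \<nu> (Pair \<theta> -` (?g -` F \<inter> space (\<H> \<Otimes>\<^sub>M \<nu>)))"
    if "F \<in> sets ?R" "\<theta> \<in> \<Theta>" for F \<theta>
  proof -
    have F: "F \<in> sets borel" using that B by (auto simp: sets_restrict_space_iff)
    then have "Pair \<theta> -` F \<in> sets borel"
      by (metis borel_prod sets_Pair1)
    moreover have "(\<lambda>x. \<theta> \<bullet> x) \<in> measurable \<nu> borel"
      using s\<nu> by (auto cong: measurable_cong_sets intro!: measurable_restrict_space1)
    moreover have "(\<lambda>x. \<theta> \<bullet> x) -` (Pair \<theta> -` F) \<inter> space \<nu> =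
        Pair \<theta> -` (?g -` F \<inter> space (\<H> \<Otimes>\<^sub>M \<nu>))"
      using that sp by (auto simp: space_pair_measure)
    ultimately show ?thesis
      by (simp add: Rd_at_def pushforward_def emeasure_distr)
  qed
  have eq: "(\<integral>\<^sup>+\<theta>. emeasure (Rd_at \<theta> \<nu>) (Pair \<theta> -` F) \<partial>\<H>) = emeasure (distr (\<H> \<Otimes>\<^sub>M \<nu>) ?R ?g) F"
    if "F \<in> sets ?R" for F
  proof -
    have "(\<integral>\<^sup>+\<theta>. emeasure (Rd_at \<theta> \<nu>) (Pair \<theta> -` F) \<partial>\<H>) =
        (\<integral>\<^sup>+\<theta>. emeasure \<nu> (Pair \<theta> -` (?g -` F \<inter> space (\<H> \<Otimes>\<^sub>M \<nu>))) \<partial>\<H>)"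
      using sec[OF that] sp by (intro nn_integral_cong) simp
    also have "\<dots> = emeasure (\<H> \<Otimes>\<^sub>M \<nu>) (?g -` F \<inter> space (\<H> \<Otimes>\<^sub>M \<nu>))"
      using g that by (subst \<nu>.emeasure_pair_measure_alt) (auto intro: measurable_sets)
    finally show ?thesis using g that by (simp add: emeasure_distr)
  qed
  have spR: "space ?R = \<Theta> \<times> Xi \<Omega> \<Theta>"
    by (simp add: space_restrict_space)
  have "sigma_sets (\<Theta> \<times> Xi \<Omega> \<Theta>) (sets ?R) = sets ?R"
    using sets.sigma_sets_eq[of ?R] by (simp only: spR)
  moreover have "sets ?R \<subseteq> Pow (\<Theta> \<times> Xi \<Omega> \<Theta>)"
    using sets.space_closed[of ?R] by (simp only: spR)
  ultimately have "Rd \<Omega> \<Theta> \<H> \<nu> =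
      measure_of (space ?R) (sets ?R) (emeasure (distr (\<H> \<Otimes>\<^sub>M \<nu>) ?R ?g))"
    unfolding Rd_def by (simp only: spR) (intro measure_of_eq, simp_all only: eq)
  also have "\<dots> = distr (\<H> \<Otimes>\<^sub>M \<nu>) ?R ?g"
    using measure_of_of_measure[of "distr (\<H> \<Otimes>\<^sub>M \<nu>) ?R ?g"] by simp
  finally show ?thesis using eq[OF E] by simp
qed

lemma emeasure_Rd_Times:
  fixes \<Omega> \<Theta> :: "(real^'d) set"
  assumes \<H>: "sets \<H> = sets (restrict_space borel \<Theta>)"
    and \<nu>: "\<nu> \<in> radon_measures \<Omega>"
    and A: "A \<in> sets \<H>" and B: "B \<in> sets (restrict_space borel (Xi \<Omega> \<Theta>))"
    and c: "compact \<Omega>" "compact \<Theta>"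
  shows "emeasure (Rd \<Omega> \<Theta> \<H> \<nu>) (A \<times> B) = (\<integral>\<^sup>+\<theta>\<in>A. emeasure (Rd_at \<theta> \<nu>) B \<partial>\<H>)"
proof -
  obtain A' B' where "A' \<in> sets borel" "B' \<in> sets borel" "A = \<Theta> \<inter> A'" "B = Xi \<Omega> \<Theta> \<inter> B'"
    using A B \<H> by (auto simp: sets_restrict_space)
  moreover from this have "A' \<times> B' \<in> sets borel"
    by (metis borel_prod pair_measureI)
  ultimately have "A \<times> B \<in> sets (restrict_space borel (\<Theta> \<times> Xi \<Omega> \<Theta>))"
    by (auto simp: sets_restrict_space intro!: image_eqI[of _ _ "A' \<times> B'"])
  then have "emeasure (Rd \<Omega> \<Theta> \<H> \<nu>) (A \<times> B) =
      (\<integral>\<^sup>+\<theta>. emeasure (Rd_at \<theta> \<nu>) (Pair \<theta> -` (A \<times> B)) \<partial>\<H>)"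
    by (intro emeasure_Rd assms)
  also have "\<dots> = (\<integral>\<^sup>+\<theta>\<in>A. emeasure (Rd_at \<theta> \<nu>) B \<partial>\<H>)"
    by (intro nn_integral_cong) (auto simp: indicator_def)
  finally show ?thesis .
qed

end

theory Submission
  imports Defs
begin

text \<open>The existence of solutions follows from the direct method. The constraint preserves mass, so along a
  minimizing sequence (or a sequence of solutions for converging data) the mass of every \<open>u t\<close> is
  bounded by the objective, and weak-* compactness provides cluster points. Integrals against
  \<open>Rd\<close> of \<open>u t\<close> are integrals of continuous functions against \<open>u t\<close>, so the constraint is
  weak-* closed; the mass is weak-* continuous, and the data term is lower semicontinuous because
  the observation operators are weak-*-to-weak continuous. In this way every cluster point of
  solutions is a solution, and uniqueness gives convergence of the entire sequence because every
  subsequence has this cluster point.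

  Weak-* sequential compactness on a compact \<open>X\<close> is reduced to Helly's theorem on the line: \<open>X\<close> is a
  continuous image of a compact \<open>K\<close> in the Cantor set (read binary digits of the coordinates off
  ternary digits), the measures are lifted to \<open>K\<close> along a Borel section, and the limit is pushed
  forward.\<close>

section \<open>Compact sets as images of compact sets of reals\<close>

text \<open>One formula serves both expansions: \<open>digit_sum (1 / 2)\<close> is twice a binary
  expansion and takes values in \<open>[0, 2]\<close>; \<open>digit_sum (1 / 3)\<close> is 3/2 times
  the usual Cantor point with ternary digits 0 and 2.\<close>

definition digit_sum :: "real \<Rightarrow> (nat \<Rightarrow> bool) \<Rightarrow> real" where
  "digit_sum q b = (\<Sum>n. of_bool (b n) * q ^ n)"

lemma summable_digits: "0 \<le> q \<Longrightarrow> q < 1 \<Longrightarrow> summable (\<lambda>n. of_bool (b n) * q ^ n :: real)"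
  by (rule summable_comparison_test'[of "\<lambda>n. q ^ n" 0]) (auto simp: summable_geometric)

text \<open>Each partial sum depends on finitely many coordinates of a product of discrete spaces,
  and the geometric majorant makes the convergence uniform.\<close>

lemma continuous_on_digit_sum:
  assumes "0 \<le> q" "q < 1"
  shows "continuous_on UNIV (digit_sum q)"
proof -
  have "uniform_limit UNIV (\<lambda>n b. \<Sum>i<n. of_bool (b i) * q ^ i) (\<lambda>b. \<Sum>i. of_bool (b i) * q ^ i) sequentially"
    using assms by (intro Weierstrass_m_test[of _ _ "\<lambda>n. q ^ n"]) (auto simp: summable_geometric)
  moreover have "continuous_on UNIV (\<lambda>b::nat \<Rightarrow> bool. \<Sum>i<n. of_bool (b i) * q ^ i)" for n
  proof -
    have "continuous_on UNIV (\<lambda>b::nat \<Rightarrow> bool. of_bool (b i) :: real)" for i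
      using continuous_on_compose[of UNIV "\<lambda>b::nat \<Rightarrow> bool. b i" "of_bool :: bool \<Rightarrow> real"]
      by (simp add: o_def continuous_on_discrete)
    then show ?thesis by (intro continuous_intros)
  qed
  ultimately show ?thesis
    unfolding digit_sum_def[abs_def] by (intro uniform_limit_theorem) auto
qed

lemma digit_sum_bounds:
  assumes "0 \<le> q" "q < 1"
  shows "0 \<le> digit_sum q b" "digit_sum q b \<le> 1 / (1 - q)"
proof -
  show "0 \<le> digit_sum q b"
    unfolding digit_sum_def using assms by (intro suminf_nonneg summable_digits) auto
  have "digit_sum q b \<le> (\<Sum>n. q ^ n)"
    unfolding digit_sum_def using assms by (intro suminf_le summable_digits) (auto simp: summable_geometric)
  then show "digit_sum q b \<le> 1 / (1 - q)"
    using assms by (simp add: suminf_geometric)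
qed

lemma digit_sum_Suc:
  assumes "0 \<le> q" "q < 1"
  shows "digit_sum q b = of_bool (b 0) + q * digit_sum q (b \<circ> Suc)"
proof -
  have "digit_sum q b = (\<Sum>n. of_bool (b (Suc n)) * q ^ Suc n) + of_bool (b 0)"
    unfolding digit_sum_def using suminf_split_head[OF summable_digits[OF assms, of b]] by simp
  also have "(\<Sum>n. of_bool (b (Suc n)) * q ^ Suc n) = q * digit_sum q (b \<circ> Suc)"
    unfolding digit_sum_def using suminf_mult[OF summable_digits[OF assms, of "b \<circ> Suc"], of q]
    by (simp add: mult_ac)
  finally show ?thesis by simp
qed

text \<open>In base 3 the digits after the first contribute at most (1/3) * (3/2) = 1/2 < 1, so the
  value determines the leading digit; stripping it off gives the induction.\<close>

lemma inj_digit_sum: "inj (digit_sum (1 / 3))"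
proof (rule injI, rule ext)
  fix b c n assume "digit_sum (1 / 3) b = digit_sum (1 / 3) c"
  then show "b n = c n"
  proof (induction n arbitrary: b c)
    case (0 b c)
    then show ?case
      using digit_sum_Suc[of "1/3" b] digit_sum_Suc[of "1/3" c]
        digit_sum_bounds[of "1/3" "b \<circ> Suc"] digit_sum_bounds[of "1/3" "c \<circ> Suc"]
      by (cases "b 0"; cases "c 0") auto
  next
    case (Suc n b c)
    then have "digit_sum (1 / 3) (b \<circ> Suc) = digit_sum (1 / 3) (c \<circ> Suc)"
      using digit_sum_Suc[of "1/3" b] digit_sum_Suc[of "1/3" c]
        digit_sum_bounds[of "1/3" "b \<circ> Suc"] digit_sum_bounds[of "1/3" "c \<circ> Suc"]
      by (cases "b 0"; cases "c 0") auto
    from Suc.IH[OF this] show ?case by simp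
  qed
qed

text \<open>The digits of \<open>x\<close> are the parities of
  \<open>\<lfloor>x * 2 ^ Suc k\<rfloor>\<close>. The factor 2 appears because the first digit after
  the binary point has weight 1 in \<open>digit_sum\<close>.\<close>

lemma digit_sum_half_onto:
  assumes x: "0 \<le> x" "x < 1"
  shows "\<exists>b. digit_sum (1 / 2) b = 2 * x"
proof -
  define b where "b k = odd \<lfloor>x * 2 ^ Suc k\<rfloor>" for k
  have floor2: "\<lfloor>2 * y\<rfloor> = 2 * \<lfloor>y\<rfloor> + of_bool (odd \<lfloor>2 * y\<rfloor>)" for y :: real
  proof -
    have "\<lfloor>2 * y\<rfloor> = 2 * \<lfloor>y\<rfloor> \<or> \<lfloor>2 * y\<rfloor> = 2 * \<lfloor>y\<rfloor> + 1" by linarith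
    then show ?thesis by auto
  qed
  \<comment> \<open>The first \<open>n\<close> digits make up (twice) the dyadic truncation of
    \<open>x\<close>, whose error is at most \<open>(1 / 2) ^ n\<close>.\<close>
  have part: "(\<Sum>k<n. of_bool (b k) * (1 / 2) ^ k) = 2 * (\<lfloor>x * 2 ^ n\<rfloor> / 2 ^ n)" for n
  proof (induction n)
    case 0
    have "\<lfloor>x\<rfloor> = 0" using x by linarith
    then show ?case by simp
  next
    case (Suc n)
    have "real_of_int \<lfloor>x * 2 ^ Suc n\<rfloor> = 2 * \<lfloor>x * 2 ^ n\<rfloor> + of_bool (b n)"
      using floor2[of "x * 2 ^ n"] unfolding b_def
      by (metis (mono_tags, opaque_lifting) mult.left_commute of_int_add of_int_mult of_int_numeral of_int_of_bool power_Suc)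
    with Suc show ?case by (simp add: field_simps power_divide)
  qed
  have "(\<lambda>n. \<lfloor>x * 2 ^ n\<rfloor> / 2 ^ n) \<longlonglongrightarrow> x"
  proof (rule real_tendsto_sandwich)
    show "(\<lambda>n. x - (1 / 2) ^ n) \<longlonglongrightarrow> x"
      by (auto intro!: tendsto_eq_intros LIMSEQ_power_zero)
    have "x - (1 / 2) ^ n \<le> \<lfloor>x * 2 ^ n\<rfloor> / 2 ^ n" for n
    proof -
      have "x * 2 ^ n - 1 \<le> \<lfloor>x * 2 ^ n\<rfloor>" by linarith
      then have "(x * 2 ^ n - 1) / 2 ^ n \<le> \<lfloor>x * 2 ^ n\<rfloor> / 2 ^ n"
        by (rule divide_right_mono) simp
      then show ?thesis by (simp add: diff_divide_distrib power_divide)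
    qed
    then show "\<forall>\<^sub>F n in sequentially. x - (1 / 2) ^ n \<le> \<lfloor>x * 2 ^ n\<rfloor> / 2 ^ n" by simp
    show "\<forall>\<^sub>F n in sequentially. \<lfloor>x * 2 ^ n\<rfloor> / 2 ^ n \<le> x"
      by (simp add: field_simps)
  qed simp
  then have "(\<lambda>n. of_bool (b n) * (1 / 2) ^ n) sums (2 * x)"
    unfolding sums_def part by (intro tendsto_intros)
  then show ?thesis unfolding digit_sum_def by (metis sums_unique)
qed

text \<open>\<open>prod_encode\<close> splits one bit sequence into a sequence for each coordinate,
  so binary expansions map the Cantor space onto a cube around \<open>X\<close>; the injective
  ternary expansion realises that space inside the reals.\<close>

lemma compact_image_of_compact_reals:
  fixes X :: "'a::euclidean_space set"
  assumes "compact X"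
  obtains K :: "real set" and g where "compact K" "continuous_on K g" "g ` K = X"
proof -
  obtain B where B: "0 < B" "\<And>x. x \<in> X \<Longrightarrow> norm x \<le> B"
    using compact_imp_bounded[OF assms] bounded_pos by metis
  obtain idx :: "'a \<Rightarrow> nat" where idx: "inj_on idx Basis"
    using finite_imp_inj_to_nat_seg[OF finite_Basis] by blast
  \<comment> \<open>The values of \<open>digit_sum (1 / 2)\<close> fill \<open>[0, 2]\<close>, so
    \<open>h\<close> covers the cube of half-width \<open>2 * B\<close>. The margin over
    \<open>B\<close> keeps the number to be expanded within \<open>[1/4, 3/4]\<close>, away from the
    excluded endpoint 1.\<close>
  define h :: "(nat \<Rightarrow> bool) \<Rightarrow> 'a" where
    "h b = (\<Sum>i\<in>Basis. (2 * B * digit_sum (1 / 2) (\<lambda>k. b (prod_encode (idx i, k))) - 2 * B) *\<^sub>R i)" for b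
  have sel: "continuous_on UNIV (\<lambda>(b::nat \<Rightarrow> bool) k. b (prod_encode (m, k)))" for m
    by (intro continuous_on_coordinatewise_then_product) simp
  have h: "continuous_on UNIV h"
    unfolding h_def[abs_def]
    by (intro continuous_intros continuous_on_compose2[OF continuous_on_digit_sum sel]) auto
  have X: "X \<subseteq> range h"
  proof
    fix x assume "x \<in> X"
    have "\<exists>b. digit_sum (1 / 2) b = 2 * ((x \<bullet> i + 2 * B) / (4 * B))" if "i \<in> Basis" for i
    proof (rule digit_sum_half_onto)
      have "\<bar>x \<bullet> i\<bar> \<le> B" using Basis_le_norm[OF that] B(2)[OF \<open>x \<in> X\<close>] order_trans by blast
      then show "0 \<le> (x \<bullet> i + 2 * B) / (4 * B)" "(x \<bullet> i + 2 * B) / (4 * B) < 1"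
        using B(1) by (auto simp: field_simps)
    qed
    then obtain c where c: "\<And>i. i \<in> Basis \<Longrightarrow> digit_sum (1 / 2) (c i) = 2 * ((x \<bullet> i + 2 * B) / (4 * B))"
      by metis
    \<comment> \<open>Interleaves the digit sequences of the coordinates. Positions whose first
      index is no \<open>idx i\<close> receive arbitrary digits, which \<open>h\<close> never
      reads.\<close>
    define b where "b n = (case prod_decode n of (m, k) \<Rightarrow> c (inv_into Basis idx m) k)" for n
    have "(\<lambda>k. b (prod_encode (idx i, k))) = c i" if "i \<in> Basis" for i
      using that idx by (simp add: b_def)
    then have "h b = (\<Sum>i\<in>Basis. (x \<bullet> i) *\<^sub>R i)"
      unfolding h_def using B(1) by (intro sum.cong) (auto simp: c field_simps)
    then show "x \<in> range h" by (metis euclidean_representation rangeI)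
  qed
  let ?e = "digit_sum (1 / 3)"
  have cpt: "compact (UNIV :: (nat \<Rightarrow> bool) set)"
  proof -
    have "compact_space (product_topology (\<lambda>i::nat. euclidean :: bool topology) UNIV)"
      unfolding compact_space_product_topology by (simp add: compact_space_def finite_imp_compact)
    then have "compact_space (euclidean :: (nat \<Rightarrow> bool) topology)"
      by (simp only: euclidean_product_topology)
    then show ?thesis by (simp add: compact_space_def)
  qed
  have e: "continuous_on UNIV ?e" by (rule continuous_on_digit_sum) auto
  define g where "g = h \<circ> inv ?e"
  \<comment> \<open>A continuous injection on a compact space has a continuous inverse on its
    image.\<close>
  have "continuous_on (range ?e) (inv ?e)"
    using continuous_on_inv[OF e cpt] inj_digit_sum by simp
  then have g: "continuous_on (range ?e) g"
    unfolding g_def by (rule continuous_on_compose) (rule continuous_on_subset[OF h], simp)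
  have R: "compact (range ?e)" using compact_continuous_image[OF e cpt] .
  define K where "K = range ?e \<inter> g -` X"
  show thesis
  proof
    show "compact K" unfolding K_def
      using continuous_closed_preimage[OF g compact_imp_closed[OF R] compact_imp_closed[OF assms]]
        R compact_Int_closed[OF R] by (metis Int_left_absorb)
    show "continuous_on K g" by (rule continuous_on_subset[OF g]) (simp add: K_def)
    have "g (?e b) = h b" for b by (simp add: g_def inj_digit_sum)
    then have "X \<subseteq> g ` range ?e" using X by (auto simp: image_image)
    then show "g ` K = X" by (auto simp: K_def)
  qed
qed

text \<open>The section picks the least preimage: its sublevel sets are the images of \<open>K \<inter> {..c}\<close>, hence compact.\<close>

lemma borel_right_inverse:
  fixes g :: "real \<Rightarrow> 'a::{t2_space}"
  assumes K: "compact K" and g: "continuous_on K g" and X: "g ` K = X"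
  obtains s where "s \<in> borel_measurable (restrict_space borel X)"
    "\<And>x. x \<in> X \<Longrightarrow> s x \<in> K" "\<And>x. x \<in> X \<Longrightarrow> g (s x) = x"
proof -
  define s where "s x = Inf (K \<inter> g -` {x})" for x
  have cl: "compact (K \<inter> g -` {x})" for x
    using continuous_closed_preimage[OF g compact_imp_closed[OF K], of "{x}"] compact_Int_closed[OF K]
    by (metis Int_left_absorb closed_singleton)
  have s: "s x \<in> K \<inter> g -` {x}" if "x \<in> X" for x
    unfolding s_def using that X cl[of x]
    by (intro closed_contains_Inf) (auto intro: compact_imp_closed bounded_imp_bdd_below compact_imp_bounded)
  have low: "s x \<le> t" if "t \<in> K" "g t = x" for x t
    unfolding s_def using that cl[of x]
    by (intro cInf_lower) (auto intro: compact_imp_closed bounded_imp_bdd_below compact_imp_bounded)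
  have "X \<in> sets borel"
    using compact_continuous_image[OF g K] X by (simp add: borel_compact)
  have "s \<in> borel_measurable (restrict_space borel X)"
  proof (rule borel_measurableI_le)
    fix c
    have "{x \<in> space (restrict_space borel X). s x \<le> c} = g ` (K \<inter> {..c})"
    proof (intro equalityI subsetI)
      fix x assume "x \<in> {x \<in> space (restrict_space borel X). s x \<le> c}"
      then have "x = g (s x)" "s x \<in> K \<inter> {..c}" using s[of x] by (auto simp: space_restrict_space)
      then show "x \<in> g ` (K \<inter> {..c})" by blast
    next
      fix x assume "x \<in> g ` (K \<inter> {..c})"
      then obtain t where "t \<in> K" "t \<le> c" "g t = x" by auto
      then show "x \<in> {x \<in> space (restrict_space borel X). s x \<le> c}"
        using low[of t x] X by (auto simp: space_restrict_space)
    qed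
    moreover have "compact (g ` (K \<inter> {..c}))"
      using K by (intro compact_continuous_image continuous_on_subset[OF g] compact_Int_closed) auto
    ultimately show "{x \<in> space (restrict_space borel X). s x \<le> c} \<in> sets (restrict_space borel X)"
      using \<open>X \<in> sets borel\<close> X by (auto simp: sets_restrict_space_iff borel_compact)
  qed
  with s that show thesis by blast
qed

section \<open>Weak-* compactness of bounded sets of measures\<close>

lemma radon_measures_measurable:
  assumes "M \<in> radon_measures X" "f \<in> measurable (restrict_space borel X) N"
  shows "f \<in> measurable M N"
  using assms by (simp add: radon_measures_def cong: measurable_cong_sets)

lemma radon_measures_borel_measurable_continuous:
  assumes "M \<in> radon_measures X" "continuous_on X f"
  shows "f \<in> borel_measurable M"
  using radon_measures_measurable[OF assms(1) borel_measurable_continuous_on_restrict[OF assms(2)]] .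

lemma continuous_on_compact_bound:
  fixes f :: "'a::topological_space \<Rightarrow> real"
  assumes "compact X" "continuous_on X f"
  obtains B where "0 \<le> B" "\<And>x. x \<in> X \<Longrightarrow> \<bar>f x\<bar> \<le> B"
proof -
  have "bounded (f ` X)" using assms by (intro compact_imp_bounded compact_continuous_image)
  then obtain B where "\<And>y. y \<in> f ` X \<Longrightarrow> norm y \<le> B" by (auto simp: bounded_iff)
  then show thesis by (intro that[of "max 0 B"]) (auto simp: max.coboundedI2)
qed

lemma radon_measures_integrable_continuous:
  fixes f :: "'a::topological_space \<Rightarrow> real"
  assumes "compact X" "M \<in> radon_measures X" "continuous_on X f"
  shows "integrable M f"
proof -
  obtain B where "\<And>x. x \<in> X \<Longrightarrow> \<bar>f x\<bar> \<le> B"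
    using continuous_on_compact_bound[OF assms(1,3)] by blast
  with assms show ?thesis
    by (intro finite_measure.integrable_const_bound[of M f B] radon_measures_borel_measurable_continuous)
      (auto simp: radon_measures_def space_radon_measures[OF assms(2)] intro!: AE_I2)
qed

text \<open>The continuous functions \<open>max 0 (1 - n * infdist x K)\<close> tend to the
  indicator of a compact \<open>K\<close>, so integrals determine the measure of compact sets; inner
  regularity does the rest.\<close>

lemma radon_measures_eqI:
  fixes M N :: "'a::metric_space measure"
  assumes M: "M \<in> radon_measures X" and N: "N \<in> radon_measures X"
    and eq: "\<And>\<phi>::'a \<Rightarrow> real. continuous_on X \<phi> \<Longrightarrow> integral\<^sup>L M \<phi> = integral\<^sup>L N \<phi>"
  shows "M = N"
proof (rule measure_eqI)
  show sets: "sets M = sets N" using M N by (simp add: radon_measures_def)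
  have lim: "(\<lambda>n. integral\<^sup>L P (\<lambda>x. max 0 (1 - real n * infdist x K))) \<longlonglongrightarrow> measure P K"
    if P: "P \<in> radon_measures X" and K: "compact K" "K \<noteq> {}" "K \<in> sets P" for P :: "'a measure" and K
  proof -
    interpret finite_measure P using P by (simp add: radon_measures_def)
    have *: "(\<lambda>n. max 0 (1 - real n * infdist x K)) \<longlonglongrightarrow> indicator K x" for x
    proof (cases "x \<in> K")
      case False
      then have "infdist x K > 0"
        using K by (simp add: infdist_pos_not_in_closed compact_imp_closed)
      then obtain m where m: "1 < real m * infdist x K"
        using reals_Archimedean3 by blast
      have "\<forall>\<^sub>F n in sequentially. max 0 (1 - real n * infdist x K) = 0"
        using eventually_ge_at_top[of m]
      proof eventually_elim
        case (elim n)
        have "real m * infdist x K \<le> real n * infdist x K"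
          using elim by (intro mult_right_mono) (auto simp: infdist_nonneg)
        with m show ?case by simp
      qed
      with False show ?thesis by (simp add: tendsto_eventually)
    qed simp
    have "(\<lambda>n. integral\<^sup>L P (\<lambda>x. max 0 (1 - real n * infdist x K))) \<longlonglongrightarrow> integral\<^sup>L P (indicator K)"
    proof (rule integral_dominated_convergence[where w="\<lambda>_. 1"])
      show "(\<lambda>x. max 0 (1 - real n * infdist x K)) \<in> borel_measurable P" for n
        by (intro radon_measures_borel_measurable_continuous[OF P] continuous_intros)
    qed (use K * in \<open>auto simp: infdist_nonneg\<close>)
    with K show ?thesis by simp
  qed
  have "measure M K = measure N K" if "compact K" "K \<in> sets M" for K
  proof (cases "K = {}")
    case False
    have "integral\<^sup>L M (\<lambda>x. max 0 (1 - real n * infdist x K)) = integral\<^sup>L N (\<lambda>x. max 0 (1 - real n * infdist x K))" for n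
      by (intro eq continuous_intros)
    then show ?thesis
      using lim[OF M that(1) False] lim[OF N that(1) False] that(2) sets LIMSEQ_unique by auto
  qed simp
  moreover have "finite_measure M" "finite_measure N" using M N by (simp_all add: radon_measures_def)
  ultimately have *: "emeasure M K = emeasure N K" if "compact K" "K \<in> sets M" for K
    using that by (simp add: finite_measure.emeasure_eq_measure)
  have "emeasure M K = emeasure N K" if "compact K" "K \<subseteq> A" "A \<in> sets M" for K A
  proof -
    have "A \<subseteq> X" using that M sets.sets_into_space space_radon_measures by blast
    \<comment> \<open>A compact subset of \<open>X\<close> is its own trace on \<open>X\<close> and
      therefore belongs to the trace sigma-algebra.\<close>
    then have "K = X \<inter> K" using that by blast
    then have "K \<in> sets M"
      using M that(1) borel_compact[OF that(1)] unfolding radon_measures_def sets_restrict_space by blast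
    then show ?thesis using * that by blast
  qed
  then have "(SUP K\<in>{K. K \<subseteq> A \<and> compact K}. emeasure M K) = (SUP K\<in>{K. K \<subseteq> A \<and> compact K}. emeasure N K)"
    if "A \<in> sets M" for A
    using that by (intro SUP_cong) auto
  moreover have "emeasure P A = (SUP K\<in>{K. K \<subseteq> A \<and> compact K}. emeasure P K)"
    if "P \<in> radon_measures X" "A \<in> sets P" for P :: "'a measure" and A
    using that unfolding radon_measures_def by blast
  ultimately show "emeasure M A = emeasure N A" if "A \<in> sets M" for A
    using that M N sets by metis
qed

lemma integral_density_const:
  fixes f :: "'a \<Rightarrow> real"
  assumes "f \<in> borel_measurable M" "0 \<le> c"
  shows "integral\<^sup>L (density M (\<lambda>_. ennreal c)) f = c * integral\<^sup>L M f"
  using assms by (simp add: integral_density)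

text \<open>Helly's selection theorem concerns probability measures, so mass and shape are
  separated: the masses converge along a subsequence as bounded reals, the normalised lifts by
  Helly, and the product of the two limits is pushed back to \<open>X\<close>.\<close>

theorem weak_star_subsequence:
  fixes X :: "'a::euclidean_space set"
  assumes X: "compact X" and Ms: "\<And>n. Ms n \<in> radon_measures X"
    and B: "\<And>n. measure (Ms n) X \<le> B"
  obtains r :: "nat \<Rightarrow> nat" and M where "strict_mono r" "M \<in> radon_measures X"
    "weak_star_tendsto X (\<lambda>k. Ms (r k)) M"
proof (cases "X = {}")
  case True
  have "integral\<^sup>L N \<phi> = 0" if "space N = {}" for N :: "'a measure" and \<phi> :: "'a \<Rightarrow> real"
    using that by (intro integral_eq_zero_AE AE_I2) auto
  then have "weak_star_tendsto X (\<lambda>k. Ms (id k)) (Ms 0)"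
    unfolding weak_star_tendsto_def using True space_radon_measures[OF Ms] by simp
  then show thesis using that[of id "Ms 0"] Ms strict_mono_id by blast
next
  case False
  obtain K and g :: "real \<Rightarrow> 'a" where K: "compact K" and g: "continuous_on K g" "g ` K = X"
    using compact_image_of_compact_reals[OF X] by metis
  obtain s where s: "s \<in> borel_measurable (restrict_space borel X)"
      "\<And>x. x \<in> X \<Longrightarrow> s x \<in> K" "\<And>x. x \<in> X \<Longrightarrow> g (s x) = x"
    using borel_right_inverse[OF K g] by metis
  obtain k0 where k0: "k0 \<in> K" using False g by auto
  have fin: "finite_measure (Ms n)" and sp: "space (Ms n) = X" for n
    using Ms[of n] space_radon_measures[OF Ms[of n]] by (simp_all add: radon_measures_def)
  have sM: "s \<in> borel_measurable (Ms n)" for n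
    using radon_measures_measurable[OF Ms s(1)] .
  have Kb: "K \<in> sets borel" using K by (rule borel_compact)
  define c where "c n = measure (Ms n) X" for n
  have c: "0 \<le> c n" "c n \<le> B" for n using B by (auto simp: c_def)
  \<comment> \<open>The normalised lift to the line along the section \<open>s\<close>. A measure of
    mass zero cannot be normalised; any probability measure on \<open>K\<close> may stand in for it,
    since it is later multiplied by \<open>c n = 0\<close>.\<close>
  define \<mu> where "\<mu> n = (if c n = 0 then return borel k0
    else distr (density (Ms n) (\<lambda>_. ennreal (1 / c n))) borel s)" for n
  have dist: "real_distribution (\<mu> n)" for n
  proof (cases "c n = 0")
    case True
    then show ?thesis
      by (auto simp: \<mu>_def real_distribution_def real_distribution_axioms_def prob_space_return)
  next
    case False
    then have "emeasure (density (Ms n) (\<lambda>_. ennreal (1 / c n))) X = 1"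
      using c[of n] sets.top[of "Ms n"]
      by (simp add: emeasure_density_const sp c_def finite_measure.emeasure_eq_measure[OF fin]
          flip: ennreal_mult)
    then have "prob_space (density (Ms n) (\<lambda>_. ennreal (1 / c n)))"
      by (intro prob_spaceI) (simp add: sp)
    with False sM show ?thesis
      by (auto simp: \<mu>_def real_distribution_def real_distribution_axioms_def intro!: prob_space.prob_space_distr)
  qed
  have AEK: "AE t in \<mu> n. t \<in> K" for n
  proof (cases "c n = 0")
    case True
    have [measurable]: "Measurable.pred borel (\<lambda>t. t \<in> K)" using Kb by simp
    have "AE t in return borel k0. t \<in> K" using k0 by (subst AE_return) auto
    then show ?thesis unfolding \<mu>_def by (simp only: True if_True simp_thms)
  next
    case False
    have "AE t in distr (density (Ms n) (\<lambda>_. ennreal (1 / c n))) borel s. t \<in> K"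
      using Kb sM s(2) by (subst AE_distr_iff) (auto simp: AE_density sp)
    then show ?thesis unfolding \<mu>_def by (simp only: False if_False simp_thms)
  qed
  interpret \<mu>: real_distribution "\<mu> n" for n by (rule dist)
  have "tight \<mu>"
    unfolding tight_def
  proof (intro conjI allI impI dist)
    fix \<epsilon> :: real assume "\<epsilon> > 0"
    obtain b where b: "0 < b" "\<And>t. t \<in> K \<Longrightarrow> norm t \<le> b"
      using compact_imp_bounded[OF K] bounded_pos by metis
    \<comment> \<open>Tightness is formulated with intervals open on the left; the extra 1 lets the
      interval contain \<open>-b\<close>.\<close>
    have sub: "t \<in> {-b - 1<..b}" if "t \<in> K" for t using b(2)[OF that] by auto
    have "AE t in \<mu> n. t \<in> {-b - 1<..b}" for n
      using AEK[of n] by eventually_elim (rule sub)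
    moreover have "{-b - 1<..b} \<in> sets (\<mu> n)" for n
      unfolding \<mu>.events_eq_borel by simp
    ultimately have "measure (\<mu> n) {-b - 1<..b} = 1" for n
      using \<mu>.AE_in_set_eq_1 by blast
    then have "\<forall>n. 1 - \<epsilon> < measure (\<mu> n) {-b - 1<..b}" using \<open>\<epsilon> > 0\<close> by (metis diff_less_eq less_add_same_cancel1)
    moreover have "-b - 1 < b" using b(1) by linarith
    ultimately show "\<exists>a b. a < b \<and> (\<forall>n. 1 - \<epsilon> < measure (\<mu> n) {a<..b})" by blast
  qed
  \<comment> \<open>The masses are made to converge first; Helly's theorem then selects a further
    subsequence inside \<open>r1\<close>.\<close>
  have "bounded (range c)" using c by (intro boundedI[of _ B]) auto
  then obtain r1 c0 where r1: "strict_mono (r1 :: nat \<Rightarrow> nat)" "(c \<circ> r1) \<longlonglongrightarrow> c0"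
    using bounded_imp_convergent_subsequence by metis
  obtain r2 N where r2: "strict_mono (r2 :: nat \<Rightarrow> nat)" and N: "real_distribution N"
      and conv: "weak_conv_m (\<mu> \<circ> r1 \<circ> r2) N"
    using tight_imp_convergent_subsubsequence[OF \<open>tight \<mu>\<close> r1(1)] by metis
  interpret N: real_distribution N by (rule N)
  have c0: "0 \<le> c0" by (rule LIMSEQ_le_const[OF r1(2)]) (use c in auto)
  have cr: "(\<lambda>k. c (r1 (r2 k))) \<longlonglongrightarrow> c0"
    using LIMSEQ_subseq_LIMSEQ[OF r1(2) r2] by (simp add: o_def)
  have intconv: "(\<lambda>k. integral\<^sup>L (\<mu> (r1 (r2 k))) f) \<longlonglongrightarrow> integral\<^sup>L N f"
    if "continuous_on UNIV f" "\<And>t. \<bar>f t\<bar> \<le> b" for f :: "real \<Rightarrow> real" and b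
    using weak_conv_imp_integral_bdd_continuous_conv[OF _ N conv, of f b] dist that
    by (simp add: o_def continuous_on_eq_continuous_at)
  \<comment> \<open>The truncated distance to \<open>K\<close> is bounded, continuous and zero
    exactly on the closed set \<open>K\<close>. Its integrals against all \<open>\<mu> n\<close>
    vanish, hence also the one against the weak limit.\<close>
  have NK: "AE t in N. t \<in> K"
  proof -
    have cont: "continuous_on UNIV (\<lambda>t. min 1 (infdist t K))" by (intro continuous_intros)
    then have meas: "(\<lambda>t. min 1 (infdist t K)) \<in> borel_measurable borel"
      by (rule borel_measurable_continuous_onI)
    have "integral\<^sup>L (\<mu> n) (\<lambda>t. min 1 (infdist t K)) = 0" for n
      by (rule integral_eq_zero_AE, use AEK[of n] in eventually_elim) auto
    then have "integral\<^sup>L N (\<lambda>t. min 1 (infdist t K)) = 0"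
      using intconv[OF cont, of 1] by (simp add: infdist_nonneg LIMSEQ_const_iff)
    moreover have "integrable N (\<lambda>t. min 1 (infdist t K))"
      using meas by (intro N.integrable_const_bound[of _ 1]) (auto simp: infdist_nonneg)
    ultimately have "AE t in N. min 1 (infdist t K) = 0"
      by (subst (asm) integral_nonneg_eq_0_iff_AE) (auto simp: infdist_nonneg)
    then show ?thesis
    proof (rule AE_mp, intro AE_I2 impI)
      fix t assume "min 1 (infdist t K) = 0"
      then have "infdist t K = 0" by (auto simp: min_def split: if_splits)
      then show "t \<in> K"
        using k0 K in_closed_iff_infdist_zero[of K t] by (auto intro: compact_imp_closed)
    qed
  qed
  \<comment> \<open>The constant value off \<open>K\<close> turns \<open>g\<close> into a Borel map
    from the whole line into \<open>X\<close>; \<open>N\<close> gives the complement of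
    \<open>K\<close> no mass.\<close>
  define h where "h t = (if t \<in> K then g t else g k0)" for t
  have hX: "h t \<in> X" for t using g k0 by (auto simp: h_def)
  have "h \<in> borel_measurable borel"
    unfolding h_def using Kb g(1)
    by (intro borel_measurable_continuous_on_if) auto
  then have h: "h \<in> measurable N (restrict_space borel X)"
    using hX by (auto simp: measurable_restrict_space2_iff)
  \<comment> \<open>The weight \<open>c0\<close> restores the limit of the masses.\<close>
  define M where "M = density (distr N (restrict_space borel X) h) (\<lambda>_. ennreal c0)"
  have "finite_measure M"
  proof
    show "emeasure M (space M) \<noteq> \<infinity>"
      using h by (simp add: M_def emeasure_density_const emeasure_distr ennreal_mult_eq_top_iff)
  qed
  then have M: "M \<in> radon_measures X"
    using X by (simp add: radon_measures_compact M_def)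
  have "(\<lambda>k. integral\<^sup>L (Ms (r1 (r2 k))) \<phi>) \<longlonglongrightarrow> integral\<^sup>L M \<phi>"
    if \<phi>: "continuous_on X \<phi>" for \<phi> :: "'a \<Rightarrow> real"
  proof -
    have \<phi>g: "continuous_on K (\<phi> \<circ> g)"
      using g \<phi> by (intro continuous_on_compose) auto
    obtain b where b: "0 \<le> b" "\<And>t. t \<in> K \<Longrightarrow> \<bar>(\<phi> \<circ> g) t\<bar> \<le> b"
      using continuous_on_compact_bound[OF K \<phi>g] by blast
    \<comment> \<open>Weak convergence on the line needs bounded continuous test functions defined
      everywhere, so \<open>\<phi> \<circ> g\<close> is extended from \<open>K\<close> by Tietze
      with the same bound.\<close>
    have "closedin (top_of_set UNIV) K" using K by (simp add: compact_imp_closed)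
    then obtain \<psi> where \<psi>: "continuous_on UNIV \<psi>" "\<And>t. t \<in> K \<Longrightarrow> \<psi> t = (\<phi> \<circ> g) t" "\<And>t. \<bar>\<psi> t\<bar> \<le> b"
      using Tietze[OF \<phi>g _ b(1)] b(2) by (metis UNIV_I real_norm_def)
    have \<psi>m: "\<psi> \<in> borel_measurable borel" using \<psi>(1) by (rule borel_measurable_continuous_onI)
    \<comment> \<open>Because \<open>s\<close> is a section with values in \<open>K\<close>,
      \<open>\<psi> (s x) = \<phi> (g (s x)) = \<phi> x\<close> on \<open>X\<close>: the lift loses
      no information about integrals.\<close>
    have 1: "integral\<^sup>L (Ms n) \<phi> = c n * integral\<^sup>L (\<mu> n) \<psi>" for n
    proof (cases "c n = 0")
      case True
      interpret finite_measure "Ms n" by (rule fin)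
      have "emeasure (Ms n) (space (Ms n)) = 0"
        using True by (simp add: c_def sp emeasure_eq_measure)
      then have "AE x in Ms n. False"
        by (intro AE_I[of _ _ "space (Ms n)"]) auto
      then have "integral\<^sup>L (Ms n) \<phi> = 0" by (intro integral_eq_zero_AE) auto
      with True show ?thesis by simp
    next
      case False
      have "integral\<^sup>L (\<mu> n) \<psi> = 1 / c n * integral\<^sup>L (Ms n) (\<lambda>x. \<psi> (s x))"
        using False c[of n] \<psi>m sM measurable_compose[OF sM \<psi>m]
        by (simp add: \<mu>_def integral_distr integral_density_const del: times_divide_eq_left)
      also have "integral\<^sup>L (Ms n) (\<lambda>x. \<psi> (s x)) = integral\<^sup>L (Ms n) \<phi>"
        using s \<psi> by (intro Bochner_Integration.integral_cong) (auto simp: sp)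
      finally show ?thesis using False by simp
    qed
    have \<phi>m: "\<phi> \<in> borel_measurable (restrict_space borel X)"
      using \<phi> by (rule borel_measurable_continuous_on_restrict)
    have "integral\<^sup>L M \<phi> = c0 * integral\<^sup>L N (\<lambda>t. \<phi> (h t))"
      unfolding M_def using c0 \<phi>m h by (simp add: integral_density_const integral_distr)
    also have "integral\<^sup>L N (\<lambda>t. \<phi> (h t)) = integral\<^sup>L N \<psi>"
    proof (rule integral_cong_AE)
      show "(\<lambda>t. \<phi> (h t)) \<in> borel_measurable N" using measurable_compose[OF h \<phi>m] .
      show "\<psi> \<in> borel_measurable N" using \<psi>m by simp
      show "AE t in N. \<phi> (h t) = \<psi> t" using NK by eventually_elim (simp add: h_def \<psi>)
    qed
    finally have 2: "integral\<^sup>L M \<phi> = c0 * integral\<^sup>L N \<psi>" .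
    show ?thesis
      unfolding 1 2 by (intro tendsto_mult cr intconv[OF \<psi>(1,3)])
  qed
  then have "weak_star_tendsto X (\<lambda>k. Ms ((r1 \<circ> r2) k)) M"
    by (simp add: weak_star_tendsto_def)
  then show thesis
    using that[OF strict_mono_o[OF r1(1) r2] M] by blast
qed

section \<open>Weak-* limits, pushforwards and products\<close>

lemma radon_measures_finite: "M \<in> radon_measures X \<Longrightarrow> finite_measure M"
  by (simp add: radon_measures_def)

lemma sets_radon_measures: "M \<in> radon_measures X \<Longrightarrow> sets M = sets (restrict_space borel X)"
  by (simp add: radon_measures_def)

lemma weak_star_tendsto_subseq:
  assumes "weak_star_tendsto X Ms M" "strict_mono s"
  shows "weak_star_tendsto X (\<lambda>k. Ms (s k)) M"
  using assms LIMSEQ_subseq_LIMSEQ unfolding weak_star_tendsto_def comp_def by blast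

text \<open>The constant 1 is an admissible test function, so no mass escapes in the limit.\<close>

lemma weak_star_tendsto_mass:
  assumes "\<And>n. Ms n \<in> radon_measures X" "M \<in> radon_measures X" "weak_star_tendsto X Ms M"
  shows "(\<lambda>n. measure (Ms n) X) \<longlonglongrightarrow> measure M X"
proof -
  have "(\<lambda>n. integral\<^sup>L (Ms n) (\<lambda>_. 1::real)) \<longlonglongrightarrow> integral\<^sup>L M (\<lambda>_. 1)"
    using assms(3) unfolding weak_star_tendsto_def by (simp del: lebesgue_integral_const)
  then show ?thesis by (simp add: space_radon_measures[OF assms(1)] space_radon_measures[OF assms(2)])
qed

lemma weak_star_tendsto_unique:
  fixes M N :: "'a::metric_space measure"
  assumes "M \<in> radon_measures X" "N \<in> radon_measures X"
    and "weak_star_tendsto X Ms M" "weak_star_tendsto X Ms N"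
  shows "M = N"
  using assms unfolding weak_star_tendsto_def
  by (intro radon_measures_eqI[OF assms(1,2)]) (metis LIMSEQ_unique)

text \<open>Repeated extraction: passing to a further subsequence for the next index keeps the
  limits already obtained.\<close>

lemma weak_star_subsequence_finite:
  fixes X :: "'a::euclidean_space set"
  assumes X: "compact X" and I: "finite I"
    and Ms: "\<And>n i. i \<in> I \<Longrightarrow> Ms n i \<in> radon_measures X"
    and B: "\<And>n i. i \<in> I \<Longrightarrow> measure (Ms n i) X \<le> B"
  shows "\<exists>(r::nat \<Rightarrow> nat) M. strict_mono r \<and>
    (\<forall>i\<in>I. M i \<in> radon_measures X \<and> weak_star_tendsto X (\<lambda>k. Ms (r k) i) (M i))"
  using I Ms B
proof (induction I)
  case empty
  then show ?case using strict_mono_id by auto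
next
  case (insert j I)
  then obtain r :: "nat \<Rightarrow> nat" and M where r: "strict_mono r"
      and M: "\<And>i. i \<in> I \<Longrightarrow> M i \<in> radon_measures X \<and> weak_star_tendsto X (\<lambda>k. Ms (r k) i) (M i)"
    by (metis insertCI)
  obtain s :: "nat \<Rightarrow> nat" and N where s: "strict_mono s" and N: "N \<in> radon_measures X"
      "weak_star_tendsto X (\<lambda>k. Ms (r (s k)) j) N"
    using weak_star_subsequence[OF X, of "\<lambda>k. Ms (r k) j" B] insert.prems by auto
  have "(M(j := N)) i \<in> radon_measures X \<and> weak_star_tendsto X (\<lambda>k. Ms ((r \<circ> s) k) i) ((M(j := N)) i)"
    if "i \<in> insert j I" for i
    using that N M[of i] weak_star_tendsto_subseq[OF _ s] by auto
  then show ?case using strict_mono_o[OF r s] by blast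
qed

section \<open>Pushforwards, products and parameter integrals\<close>

lemma
  fixes X :: "'a::topological_space set" and Y :: "'b::polish_space set"
  assumes M: "M \<in> radon_measures X" and Y: "compact Y"
    and g: "continuous_on X g" "g ` X \<subseteq> Y"
  shows pushforward_radon_measures: "pushforward Y g M \<in> radon_measures Y"
    and integral_pushforward: "continuous_on Y \<phi> \<Longrightarrow> integral\<^sup>L (pushforward Y g M) \<phi> = integral\<^sup>L M (\<lambda>x. \<phi> (g x) :: real)"
    and measure_pushforward: "measure (pushforward Y g M) Y = measure M X"
proof -
  \<comment> \<open>On a compact set of a Polish space every finite Borel measure is Radon, so
    measurability of \<open>g\<close> is all that the image measure requires.\<close>
  have "g \<in> measurable (restrict_space borel X) (restrict_space borel Y)"
    using g by (auto simp: measurable_restrict_space2_iff space_restrict_space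
        intro: borel_measurable_continuous_on_restrict)
  then have meas: "g \<in> measurable M (restrict_space borel Y)"
    by (rule radon_measures_measurable[OF M])
  show "pushforward Y g M \<in> radon_measures Y"
    using radon_measures_finite[OF M] meas
    by (simp add: radon_measures_compact[OF Y] pushforward_def finite_measure.finite_measure_distr)
  show "integral\<^sup>L (pushforward Y g M) \<phi> = integral\<^sup>L M (\<lambda>x. \<phi> (g x))" if "continuous_on Y \<phi>"
    unfolding pushforward_def
    by (rule integral_distr[OF meas borel_measurable_continuous_on_restrict[OF that]])
  have "g -` Y \<inter> X = X" using g by auto
  moreover have "Y \<in> sets (restrict_space borel Y)"
    using sets.top[of "restrict_space borel Y"] by (simp add: space_restrict_space)
  ultimately show "measure (pushforward Y g M) Y = measure M X"
    using meas by (simp add: pushforward_def measure_distr space_radon_measures[OF M])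
qed

text \<open>Puts product measures on the sigma-algebra that \<open>radon_measures\<close> demands.
  The identity is measurable in both directions; second countability makes the Borel sets of the
  product the product sigma-algebra.\<close>

lemma sets_pair_restrict_borel:
  fixes A :: "'a::second_countable_topology set" and B :: "'b::second_countable_topology set"
  shows "sets (restrict_space borel A \<Otimes>\<^sub>M restrict_space borel B) = sets (restrict_space borel (A \<times> B))"
proof -
  let ?P = "restrict_space borel A \<Otimes>\<^sub>M restrict_space borel B" and ?R = "restrict_space borel (A \<times> B)"
  have sp: "space ?P = A \<times> B" "space ?R = A \<times> B"
    by (auto simp: space_pair_measure space_restrict_space)
  have "fst \<in> measurable ?R borel" "snd \<in> measurable ?R borel"
    by (intro borel_measurable_continuous_on_restrict continuous_intros)+
  then have "(\<lambda>x. x) \<in> measurable ?R ?P"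
    by (intro measurable_pair) (auto simp: measurable_restrict_space2_iff space_restrict_space o_def)
  then have 1: "C \<in> sets ?R" if "C \<in> sets ?P" for C
    using measurable_sets[of "\<lambda>x. x" ?R ?P C] that sets.sets_into_space[OF that] by (simp add: sp Int_absorb2)
  have "fst \<in> measurable ?P borel" "snd \<in> measurable ?P borel"
    using measurable_fst[of "restrict_space borel A" "restrict_space borel B"]
      measurable_snd[of "restrict_space borel A" "restrict_space borel B"]
    by (auto simp: measurable_restrict_space2_iff)
  then have "(\<lambda>p. (fst p, snd p)) \<in> measurable ?P borel" by (rule borel_measurable_Pair)
  then have "(\<lambda>x. x) \<in> measurable ?P ?R"
    by (auto simp: measurable_restrict_space2_iff sp)
  then have "C \<in> sets ?P" if "C \<in> sets ?R" for C
    using measurable_sets[of "\<lambda>x. x" ?P ?R C] that sets.sets_into_space[OF that] by (simp add: sp Int_absorb2)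
  with 1 show ?thesis by blast
qed

lemma
  fixes X :: "'a::euclidean_space set" and Y :: "'b::euclidean_space set"
  assumes X: "compact X" and Y: "compact Y" and M: "M \<in> radon_measures X" and N: "N \<in> radon_measures Y"
  shows radon_measures_pair: "M \<Otimes>\<^sub>M N \<in> radon_measures (X \<times> Y)"
    and measure_radon_measures_pair: "measure (M \<Otimes>\<^sub>M N) (X \<times> Y) = measure M X * measure N Y"
    and integral_radon_measures_pair: "continuous_on (X \<times> Y) \<phi> \<Longrightarrow>
      integral\<^sup>L (M \<Otimes>\<^sub>M N) \<phi> = (\<integral>y. (\<integral>x. \<phi> (x, y) \<partial>M) \<partial>N :: real)"
proof -
  interpret M: finite_measure M by (rule radon_measures_finite[OF M])
  interpret N: finite_measure N by (rule radon_measures_finite[OF N])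
  interpret MN: pair_sigma_finite M N ..
  have "sets (M \<Otimes>\<^sub>M N) = sets (restrict_space borel (X \<times> Y))"
    using sets_pair_restrict_borel[of X Y] sets_pair_measure_cong[OF sets_radon_measures[OF M] sets_radon_measures[OF N]]
    by simp
  then show MN: "M \<Otimes>\<^sub>M N \<in> radon_measures (X \<times> Y)"
    by (simp add: radon_measures_compact[OF compact_Times[OF X Y]] finite_measure_pair_measure
        M.finite_measure_axioms N.finite_measure_axioms)
  have "X \<in> sets M" "Y \<in> sets N"
    using sets.top[of M] sets.top[of N] by (simp_all add: space_radon_measures[OF M] space_radon_measures[OF N])
  then show "measure (M \<Otimes>\<^sub>M N) (X \<times> Y) = measure M X * measure N Y"
    by (simp add: measure_def N.emeasure_pair_measure_Times enn2real_mult)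
  show "integral\<^sup>L (M \<Otimes>\<^sub>M N) \<phi> = (\<integral>y. (\<integral>x. \<phi> (x, y) \<partial>M) \<partial>N)" if "continuous_on (X \<times> Y) \<phi>"
    using MN.integral_snd[of "\<lambda>x y. \<phi> (x, y)"]
      radon_measures_integrable_continuous[OF compact_Times[OF X Y] MN that] by simp
qed

text \<open>Dominated convergence, with the maximum of \<open>\<bar>\<phi>\<bar>\<close> on the
  compact product as dominating constant. It makes averages over directions legitimate test
  functions.\<close>

lemma continuous_on_integral_parameter:
  fixes X :: "'a::metric_space set" and Y :: "'b::metric_space set" and \<phi> :: "'a \<times> 'b \<Rightarrow> real"
  assumes X: "compact X" and Y: "compact Y" and M: "M \<in> radon_measures X" and \<phi>: "continuous_on (X \<times> Y) \<phi>"
  shows "continuous_on Y (\<lambda>y. \<integral>x. \<phi> (x, y) \<partial>M)"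
proof (unfold continuous_on_sequentially, intro allI ballI impI)
  interpret finite_measure M by (rule radon_measures_finite[OF M])
  fix y0 ys assume y0: "y0 \<in> Y" and "(\<forall>n. ys n \<in> Y) \<and> ys \<longlonglongrightarrow> y0"
  then have ys: "\<And>n. ys n \<in> Y" "ys \<longlonglongrightarrow> y0" by auto
  obtain B where B: "\<And>p. p \<in> X \<times> Y \<Longrightarrow> \<bar>\<phi> p\<bar> \<le> B"
    using continuous_on_compact_bound[OF compact_Times[OF X Y] \<phi>] by blast
  have slice: "(\<lambda>x. \<phi> (x, y)) \<in> borel_measurable M" if "y \<in> Y" for y
    using that
    by (intro radon_measures_borel_measurable_continuous[OF M] continuous_on_compose2[OF \<phi>] continuous_intros) auto
  have "(\<lambda>n. \<integral>x. \<phi> (x, ys n) \<partial>M) \<longlonglongrightarrow> (\<integral>x. \<phi> (x, y0) \<partial>M)"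
  proof (rule integral_dominated_convergence[where w="\<lambda>_. B"])
    show "AE x in M. (\<lambda>n. \<phi> (x, ys n)) \<longlonglongrightarrow> \<phi> (x, y0)"
    proof (rule AE_I2)
      fix x assume "x \<in> space M"
      then have "x \<in> X" by (simp add: space_radon_measures[OF M])
      moreover have "(\<lambda>n. (x, ys n)) \<longlonglongrightarrow> (x, y0)" using ys(2) by (intro tendsto_intros)
      ultimately show "(\<lambda>n. \<phi> (x, ys n)) \<longlonglongrightarrow> \<phi> (x, y0)"
        using \<phi>[unfolded continuous_on_sequentially comp_def, rule_format, of "(x, y0)" "\<lambda>n. (x, ys n)"]
          y0 ys(1) by simp
    qed
    show "AE x in M. norm (\<phi> (x, ys n)) \<le> B" for n
      using B ys(1) by (intro AE_I2) (simp add: space_radon_measures[OF M])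
  qed (simp_all add: slice y0 ys(1))
  then show "((\<lambda>y. \<integral>x. \<phi> (x, y) \<partial>M) \<circ> ys) \<longlonglongrightarrow> (\<integral>x. \<phi> (x, y0) \<partial>M)"
    by (simp add: comp_def)
qed

section \<open>The constraint of the problem\<close>

text \<open>Only the geometry and the measure on directions: the setting of the constraint, before
  any observation enters.\<close>

locale dynamic_radon =
  fixes \<Omega> \<Theta> :: "(real^'d) set" and S :: "real set" and \<H> :: "(real^'d) measure"
  assumes compact_\<Omega>: "compact \<Omega>" and compact_\<Theta>: "compact \<Theta>" and compact_Lam: "compact (Lam \<Omega> S)"
    and sets_\<H>: "sets \<H> = sets (restrict_space borel \<Theta>)" and prob_\<H>: "prob_space \<H>"
begin

abbreviation "\<Gamma> \<equiv> Gam \<Omega> S \<Theta>"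
abbreviation "\<Xi> \<equiv> Xi \<Omega> \<Theta>"

lemma compact_Xi: "compact \<Xi>"
proof -
  have "\<Xi> = (\<lambda>(x, \<theta>). \<theta> \<bullet> x) ` (\<Omega> \<times> \<Theta>)" by (auto simp: Xi_def)
  moreover have "compact ((\<lambda>(x, \<theta>). \<theta> \<bullet> x) ` (\<Omega> \<times> \<Theta>))"
    by (intro compact_continuous_image compact_Times compact_\<Omega> compact_\<Theta>)
      (auto simp: case_prod_beta intro!: continuous_intros)
  ultimately show ?thesis by simp
qed

lemma compact_Gam: "compact \<Gamma>"
proof -
  have "\<Gamma> = (\<lambda>((x, v), \<theta>). (\<theta> \<bullet> x, \<theta> \<bullet> v)) ` (Lam \<Omega> S \<times> \<Theta>)"
    by (force simp: Gam_def)
  moreover have "compact ((\<lambda>((x, v), \<theta>). (\<theta> \<bullet> x, \<theta> \<bullet> v)) ` (Lam \<Omega> S \<times> \<Theta>))"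
    by (intro compact_continuous_image compact_Times compact_Lam compact_\<Theta>)
      (auto simp: case_prod_beta intro!: continuous_intros)
  ultimately show ?thesis by simp
qed

lemmas compact_product_Xi = compact_Times[OF compact_\<Theta> compact_Xi]
lemmas compact_product_Gam = compact_Times[OF compact_\<Theta> compact_Gam]

lemma \<H>_radon: "\<H> \<in> radon_measures \<Theta>"
  using prob_\<H> sets_\<H> by (simp add: radon_measures_compact[OF compact_\<Theta>] prob_space_def)

lemma measure_\<H>: "measure \<H> \<Theta> = 1"
  using prob_space.prob_space[OF prob_\<H>] by (simp add: space_radon_measures[OF \<H>_radon])

lemma projection_in_Xi: "(\<lambda>(\<theta>, x). (\<theta>, \<theta> \<bullet> x)) ` (\<Theta> \<times> \<Omega>) \<subseteq> \<Theta> \<times> \<Xi>"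
  by (auto simp: Xi_def)

lemma continuous_on_projection: "continuous_on A (\<lambda>(\<theta>, x). (\<theta>, \<theta> \<bullet> x))"
  by (auto simp: case_prod_beta intro!: continuous_intros)

text \<open>\<open>\<Theta> \<times> \<Gamma>\<close> is a full product, so the direction
  \<open>\<theta>'\<close> behind a point of \<open>\<Gamma>\<close> may differ from the first
  component \<open>\<theta>\<close>. The image still lies in \<open>\<Theta> \<times> \<Xi>\<close>,
  because \<open>\<Xi>\<close> collects the projections along all directions.\<close>

lemma move_in_Xi: "t \<in> S \<Longrightarrow> (\<lambda>(\<theta>, x, v). (\<theta>, x + t * v)) ` (\<Theta> \<times> \<Gamma>) \<subseteq> \<Theta> \<times> \<Xi>"
proof (intro subsetI)
  fix p assume t: "t \<in> S" and "p \<in> (\<lambda>(\<theta>, x, v). (\<theta>, x + t * v)) ` (\<Theta> \<times> \<Gamma>)"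
  then obtain \<theta> x v \<theta>' where "\<theta> \<in> \<Theta>" and p: "p = (\<theta>, \<theta>' \<bullet> x + t * (\<theta>' \<bullet> v))"
      and \<theta>': "\<theta>' \<in> \<Theta>" and xv: "(x, v) \<in> Lam \<Omega> S"
    by (auto simp: Gam_def)
  have "\<theta>' \<bullet> x + t * (\<theta>' \<bullet> v) = \<theta>' \<bullet> (x + t *\<^sub>R v)" by (simp add: inner_add_right)
  moreover have "x + t *\<^sub>R v \<in> \<Omega>" using xv t by (auto simp: Lam_def)
  ultimately have "\<theta>' \<bullet> x + t * (\<theta>' \<bullet> v) \<in> \<Xi>" using \<theta>' unfolding Xi_def by blast
  with \<open>\<theta> \<in> \<Theta>\<close> p show "p \<in> \<Theta> \<times> \<Xi>" by simp
qed

lemma continuous_on_move: "continuous_on A (\<lambda>(\<theta>, x, v). (\<theta> :: real^'d, x + t * v :: real))"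
  by (auto simp: case_prod_beta intro!: continuous_intros)

text \<open>The formula by sections is Fubini for the image of
  \<open>\<H> \<Otimes>\<^sub>M \<nu>\<close>. In this form mass, regularity and integrals of
  \<open>Rd\<close> follow from the general facts on products and pushforwards.\<close>

lemma Rd_eq_pushforward:
  assumes \<nu>: "\<nu> \<in> radon_measures \<Omega>"
  shows "Rd \<Omega> \<Theta> \<H> \<nu> = pushforward (\<Theta> \<times> \<Xi>) (\<lambda>(\<theta>, x). (\<theta>, \<theta> \<bullet> x)) (\<H> \<Otimes>\<^sub>M \<nu>)"
    (is "_ = pushforward _ ?g _")
proof (rule measure_eqI)
  let ?R = "restrict_space borel (\<Theta> \<times> \<Xi>) :: ((real^'d) \<times> real) measure"
  interpret \<nu>: finite_measure \<nu> by (rule radon_measures_finite[OF \<nu>])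
  note pair = radon_measures_pair[OF compact_\<Theta> compact_\<Omega> \<H>_radon \<nu>]
  have spR: "space ?R = \<Theta> \<times> \<Xi>" by (simp add: space_restrict_space)
  have "sigma_sets (\<Theta> \<times> \<Xi>) (sets ?R) = sets ?R" "sets ?R \<subseteq> Pow (\<Theta> \<times> \<Xi>)"
    using sets.sigma_sets_eq[of ?R] sets.space_closed[of ?R] by (simp_all only: spR)
  then have setsR: "sets (Rd \<Omega> \<Theta> \<H> \<nu>) = sets ?R"
    unfolding Rd_def by (simp only: sets_measure_of)
  then show "sets (Rd \<Omega> \<Theta> \<H> \<nu>) = sets (pushforward (\<Theta> \<times> \<Xi>) ?g (\<H> \<Otimes>\<^sub>M \<nu>))"
    by (simp add: pushforward_def)
  fix E assume "E \<in> sets (Rd \<Omega> \<Theta> \<H> \<nu>)"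
  with setsR have E: "E \<in> sets ?R" by simp
  have g: "?g \<in> measurable (\<H> \<Otimes>\<^sub>M \<nu>) ?R"
    by (rule radon_measures_measurable[OF pair])
      (use projection_in_Xi in \<open>auto simp: measurable_restrict_space2_iff space_restrict_space
        intro!: borel_measurable_continuous_on_restrict continuous_on_projection\<close>)
  have "emeasure (Rd \<Omega> \<Theta> \<H> \<nu>) E = (\<integral>\<^sup>+\<theta>. emeasure (Rd_at \<theta> \<nu>) (Pair \<theta> -` E) \<partial>\<H>)"
    by (rule emeasure_Rd[OF sets_\<H> \<nu> E compact_\<Omega> compact_\<Theta>])
  also have "\<dots> = (\<integral>\<^sup>+\<theta>. emeasure \<nu> (Pair \<theta> -` (?g -` E \<inter> space (\<H> \<Otimes>\<^sub>M \<nu>))) \<partial>\<H>)"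
  proof (rule nn_integral_cong)
    fix \<theta> assume "\<theta> \<in> space \<H>"
    then have \<theta>: "\<theta> \<in> \<Theta>" by (simp add: space_radon_measures[OF \<H>_radon])
    have "E \<in> sets borel"
      using E borel_compact[OF compact_product_Xi] by (simp add: sets_restrict_space_iff)
    then have "Pair \<theta> -` E \<in> sets borel" by (metis borel_prod sets_Pair1)
    moreover have "(\<lambda>x. \<theta> \<bullet> x) \<in> measurable \<nu> borel"
      by (intro radon_measures_borel_measurable_continuous[OF \<nu>] continuous_intros)
    moreover have "(\<lambda>x. \<theta> \<bullet> x) -` (Pair \<theta> -` E) \<inter> space \<nu> = Pair \<theta> -` (?g -` E \<inter> space (\<H> \<Otimes>\<^sub>M \<nu>))"
      using \<theta> by (auto simp: space_pair_measure space_radon_measures[OF \<H>_radon] space_radon_measures[OF \<nu>])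
    ultimately show "emeasure (Rd_at \<theta> \<nu>) (Pair \<theta> -` E) =
        emeasure \<nu> (Pair \<theta> -` (?g -` E \<inter> space (\<H> \<Otimes>\<^sub>M \<nu>)))"
      by (simp add: Rd_at_def pushforward_def emeasure_distr)
  qed
  also have "\<dots> = emeasure (\<H> \<Otimes>\<^sub>M \<nu>) (?g -` E \<inter> space (\<H> \<Otimes>\<^sub>M \<nu>))"
    by (rule \<nu>.emeasure_pair_measure_alt[symmetric]) (rule measurable_sets[OF g E])
  finally show "emeasure (Rd \<Omega> \<Theta> \<H> \<nu>) E = emeasure (pushforward (\<Theta> \<times> \<Xi>) ?g (\<H> \<Otimes>\<^sub>M \<nu>)) E"
    using g E by (simp add: pushforward_def emeasure_distr)
qed

text \<open>Mass is preserved since \<open>\<H>\<close> has mass 1. The integral formula identifies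
  the predual operator of \<open>Rd\<close>: averaging
  \<open>\<phi> (\<theta>, \<theta> \<bullet> x)\<close> over the directions.\<close>

lemma
  assumes \<nu>: "\<nu> \<in> radon_measures \<Omega>"
  shows Rd_radon_measures: "Rd \<Omega> \<Theta> \<H> \<nu> \<in> radon_measures (\<Theta> \<times> \<Xi>)"
    and measure_Rd: "measure (Rd \<Omega> \<Theta> \<H> \<nu>) (\<Theta> \<times> \<Xi>) = measure \<nu> \<Omega>"
    and integral_Rd: "continuous_on (\<Theta> \<times> \<Xi>) \<phi> \<Longrightarrow>
      integral\<^sup>L (Rd \<Omega> \<Theta> \<H> \<nu>) \<phi> = (\<integral>x. (\<integral>\<theta>. \<phi> (\<theta>, \<theta> \<bullet> x) \<partial>\<H>) \<partial>\<nu> :: real)"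
proof -
  note pair = radon_measures_pair[OF compact_\<Theta> compact_\<Omega> \<H>_radon \<nu>]
  show "Rd \<Omega> \<Theta> \<H> \<nu> \<in> radon_measures (\<Theta> \<times> \<Xi>)" "measure (Rd \<Omega> \<Theta> \<H> \<nu>) (\<Theta> \<times> \<Xi>) = measure \<nu> \<Omega>"
    using pushforward_radon_measures[OF pair compact_product_Xi continuous_on_projection projection_in_Xi]
      measure_pushforward[OF pair compact_product_Xi continuous_on_projection projection_in_Xi]
    by (simp_all add: Rd_eq_pushforward[OF \<nu>] measure_\<H>
        measure_radon_measures_pair[OF compact_\<Theta> compact_\<Omega> \<H>_radon \<nu>])
  assume \<phi>: "continuous_on (\<Theta> \<times> \<Xi>) \<phi>"
  have "continuous_on (\<Theta> \<times> \<Omega>) (\<lambda>p. \<phi> (case p of (\<theta>, x) \<Rightarrow> (\<theta>, \<theta> \<bullet> x)))"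
    by (rule continuous_on_compose2[OF \<phi> continuous_on_projection projection_in_Xi])
  from integral_radon_measures_pair[OF compact_\<Theta> compact_\<Omega> \<H>_radon \<nu> this]
  show "integral\<^sup>L (Rd \<Omega> \<Theta> \<H> \<nu>) \<phi> = (\<integral>x. (\<integral>\<theta>. \<phi> (\<theta>, \<theta> \<bullet> x) \<partial>\<H>) \<partial>\<nu>)"
    using integral_pushforward[OF pair compact_product_Xi continuous_on_projection projection_in_Xi \<phi>]
    by (simp add: Rd_eq_pushforward[OF \<nu>])
qed

lemma continuous_on_integral_projection:
  fixes \<phi> :: "(real^'d) \<times> real \<Rightarrow> real"
  assumes "continuous_on (\<Theta> \<times> \<Xi>) \<phi>"
  shows "continuous_on \<Omega> (\<lambda>x. \<integral>\<theta>. \<phi> (\<theta>, \<theta> \<bullet> x) \<partial>\<H>)"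
  using continuous_on_integral_parameter[OF compact_\<Theta> compact_\<Omega> \<H>_radon
      continuous_on_compose2[OF assms continuous_on_projection projection_in_Xi]] by simp

text \<open>Testing \<open>Rd\<close> of a measure against \<open>\<phi>\<close> is testing the
  measure itself against the directional average of \<open>\<phi>\<close>, which is continuous on
  \<open>\<Omega>\<close>.\<close>

lemma weak_star_tendsto_Rd:
  assumes "\<And>n. \<nu>s n \<in> radon_measures \<Omega>" "\<nu> \<in> radon_measures \<Omega>" "weak_star_tendsto \<Omega> \<nu>s \<nu>"
  shows "weak_star_tendsto (\<Theta> \<times> \<Xi>) (\<lambda>n. Rd \<Omega> \<Theta> \<H> (\<nu>s n)) (Rd \<Omega> \<Theta> \<H> \<nu>)"
  using assms continuous_on_integral_projection by (simp add: weak_star_tendsto_def integral_Rd)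

section \<open>The move operator and closedness of the constraint\<close>

lemma
  assumes t: "t \<in> S" and \<gamma>: "\<gamma> \<in> radon_measures (\<Theta> \<times> \<Gamma>)"
  shows Mv_bar_radon_measures: "Mv_bar \<Omega> \<Theta> t \<gamma> \<in> radon_measures (\<Theta> \<times> \<Xi>)"
    and measure_Mv_bar: "measure (Mv_bar \<Omega> \<Theta> t \<gamma>) (\<Theta> \<times> \<Xi>) = measure \<gamma> (\<Theta> \<times> \<Gamma>)"
    and integral_Mv_bar: "continuous_on (\<Theta> \<times> \<Xi>) \<phi> \<Longrightarrow>
      integral\<^sup>L (Mv_bar \<Omega> \<Theta> t \<gamma>) \<phi> = (\<integral>(\<theta>, x, v). \<phi> (\<theta>, x + t * v) \<partial>\<gamma> :: real)"
  using pushforward_radon_measures[OF \<gamma> compact_product_Xi continuous_on_move move_in_Xi[OF t]]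
    measure_pushforward[OF \<gamma> compact_product_Xi continuous_on_move move_in_Xi[OF t]]
    integral_pushforward[OF \<gamma> compact_product_Xi continuous_on_move move_in_Xi[OF t]]
  by (simp_all add: Mv_bar_def case_prod_unfold)

lemma weak_star_tendsto_Mv_bar:
  assumes t: "t \<in> S" and "\<And>n. \<gamma>s n \<in> radon_measures (\<Theta> \<times> \<Gamma>)" "\<gamma> \<in> radon_measures (\<Theta> \<times> \<Gamma>)"
    and "weak_star_tendsto (\<Theta> \<times> \<Gamma>) \<gamma>s \<gamma>"
  shows "weak_star_tendsto (\<Theta> \<times> \<Xi>) (\<lambda>n. Mv_bar \<Omega> \<Theta> t (\<gamma>s n)) (Mv_bar \<Omega> \<Theta> t \<gamma>)"
proof -
  have "continuous_on (\<Theta> \<times> \<Gamma>) (\<lambda>(\<theta>, x, v). \<phi> (\<theta>, x + t * v))"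
    if "continuous_on (\<Theta> \<times> \<Xi>) \<phi>" for \<phi> :: "(real^'d) \<times> real \<Rightarrow> real"
    using continuous_on_compose2[OF that continuous_on_move move_in_Xi[OF t]] by (simp add: case_prod_beta)
  with assms show ?thesis by (simp add: weak_star_tendsto_def integral_Mv_bar)
qed

text \<open>Both operators preserve mass. Hence bounding \<open>\<gamma>\<close> alone bounds every
  \<open>u t\<close>, including the unobserved times.\<close>

lemma mass_eq_of_constraint:
  assumes "t \<in> S" "\<gamma> \<in> radon_measures (\<Theta> \<times> \<Gamma>)" "\<nu> \<in> radon_measures \<Omega>" "Mv_bar \<Omega> \<Theta> t \<gamma> = Rd \<Omega> \<Theta> \<H> \<nu>"
  shows "measure \<nu> \<Omega> = measure \<gamma> (\<Theta> \<times> \<Gamma>)"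
  using measure_Mv_bar[OF assms(1,2)] measure_Rd[OF assms(3)] assms(4) by simp

text \<open>Both sides of the constraint are weak-* continuous and weak-* limits are unique.\<close>

lemma constraint_closed:
  assumes t: "t \<in> S"
    and \<gamma>s: "\<And>n. \<gamma>s n \<in> radon_measures (\<Theta> \<times> \<Gamma>)" "\<gamma> \<in> radon_measures (\<Theta> \<times> \<Gamma>)" "weak_star_tendsto (\<Theta> \<times> \<Gamma>) \<gamma>s \<gamma>"
    and \<nu>s: "\<And>n. \<nu>s n \<in> radon_measures \<Omega>" "\<nu> \<in> radon_measures \<Omega>" "weak_star_tendsto \<Omega> \<nu>s \<nu>"
    and eq: "\<And>n. Mv_bar \<Omega> \<Theta> t (\<gamma>s n) = Rd \<Omega> \<Theta> \<H> (\<nu>s n)"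
  shows "Mv_bar \<Omega> \<Theta> t \<gamma> = Rd \<Omega> \<Theta> \<H> \<nu>"
  using weak_star_tendsto_Mv_bar[OF t \<gamma>s] weak_star_tendsto_Rd[OF \<nu>s]
  unfolding eq by (rule weak_star_tendsto_unique[OF Mv_bar_radon_measures[OF t \<gamma>s(2)] Rd_radon_measures[OF \<nu>s(2)]])

text \<open>Source of feasible points: a measure on phase space induces the snapshots
  \<open>Mv \<Omega> t m\<close> and, by projecting position and velocity along each direction, a
  matching \<open>\<gamma>\<close>.\<close>

lemma lift_radon_measure:
  assumes m: "m \<in> radon_measures (Lam \<Omega> S)"
  obtains \<gamma> where "\<gamma> \<in> radon_measures (\<Theta> \<times> \<Gamma>)"
    "\<And>t. t \<in> S \<Longrightarrow> Mv \<Omega> t m \<in> radon_measures \<Omega>"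
    "\<And>t. t \<in> S \<Longrightarrow> Mv_bar \<Omega> \<Theta> t \<gamma> = Rd \<Omega> \<Theta> \<H> (Mv \<Omega> t m)"
proof -
  let ?g = "\<lambda>(\<theta>, x, v). (\<theta>, \<theta> \<bullet> x, \<theta> \<bullet> v) :: (real^'d) \<times> real \<times> real"
  let ?\<gamma> = "pushforward (\<Theta> \<times> \<Gamma>) ?g (\<H> \<Otimes>\<^sub>M m)"
  note pair = radon_measures_pair[OF compact_\<Theta> compact_Lam \<H>_radon m]
  have g: "continuous_on (\<Theta> \<times> Lam \<Omega> S) ?g" "?g ` (\<Theta> \<times> Lam \<Omega> S) \<subseteq> \<Theta> \<times> \<Gamma>"
    unfolding Gam_def by (auto simp: case_prod_beta intro!: continuous_intros) blast
  have \<gamma>: "?\<gamma> \<in> radon_measures (\<Theta> \<times> \<Gamma>)"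
    by (rule pushforward_radon_measures[OF pair compact_product_Gam g])
  have h: "continuous_on (Lam \<Omega> S) (\<lambda>(x, v). x + t *\<^sub>R v)" "(\<lambda>(x, v). x + t *\<^sub>R v) ` Lam \<Omega> S \<subseteq> \<Omega>"
    if "t \<in> S" for t
    using that by (auto simp: case_prod_beta Lam_def intro!: continuous_intros)
  have u: "Mv \<Omega> t m \<in> radon_measures \<Omega>" if "t \<in> S" for t
    unfolding Mv_def by (rule pushforward_radon_measures[OF m compact_\<Omega> h[OF that]])
  have "Mv_bar \<Omega> \<Theta> t ?\<gamma> = Rd \<Omega> \<Theta> \<H> (Mv \<Omega> t m)" if t: "t \<in> S" for t
  proof (rule radon_measures_eqI[OF Mv_bar_radon_measures[OF t \<gamma>] Rd_radon_measures[OF u[OF t]]])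
    fix \<phi> :: "(real^'d) \<times> real \<Rightarrow> real" assume \<phi>: "continuous_on (\<Theta> \<times> \<Xi>) \<phi>"
    have cont: "continuous_on (\<Theta> \<times> \<Gamma>) (\<lambda>(\<theta>, x, v). \<phi> (\<theta>, x + t * v))"
      using continuous_on_compose2[OF \<phi> continuous_on_move move_in_Xi[OF t]] by (simp add: case_prod_beta)
    have "integral\<^sup>L (Mv_bar \<Omega> \<Theta> t ?\<gamma>) \<phi> = (\<integral>p. (case ?g p of (\<theta>, x, v) \<Rightarrow> \<phi> (\<theta>, x + t * v)) \<partial>(\<H> \<Otimes>\<^sub>M m))"
      unfolding integral_Mv_bar[OF t \<gamma> \<phi>]
      by (rule integral_pushforward[OF pair compact_product_Gam g cont])
    \<comment> \<open>Projecting and moving commute: \<open>\<theta> \<bullet> x + t * (\<theta>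
      \<bullet> v) = \<theta> \<bullet> (x + t *\<^sub>R v)\<close>.\<close>
    also have "\<dots> = (\<integral>(x, v). (\<integral>\<theta>. \<phi> (\<theta>, \<theta> \<bullet> (x + t *\<^sub>R v)) \<partial>\<H>) \<partial>m)"
      using integral_radon_measures_pair[OF compact_\<Theta> compact_Lam \<H>_radon m continuous_on_compose2[OF cont g]]
      by (simp add: case_prod_unfold inner_add_right)
    also have "\<dots> = integral\<^sup>L (Rd \<Omega> \<Theta> \<H> (Mv \<Omega> t m)) \<phi>"
      unfolding integral_Rd[OF u[OF t] \<phi>] unfolding Mv_def
      by (subst integral_pushforward[OF m compact_\<Omega> h[OF t] continuous_on_integral_projection[OF \<phi>]])
        (simp add: case_prod_unfold)
    finally show "integral\<^sup>L (Mv_bar \<Omega> \<Theta> t ?\<gamma>) \<phi> = integral\<^sup>L (Rd \<Omega> \<Theta> \<H> (Mv \<Omega> t m)) \<phi>" .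
  qed
  with \<gamma> u show thesis using that by blast
qed

end

section \<open>Cluster points and solutions\<close>

lemma not_tendsto_subseq:
  fixes x :: "nat \<Rightarrow> real"
  assumes "\<not> x \<longlonglongrightarrow> l"
  obtains e and r :: "nat \<Rightarrow> nat" where "0 < e" "strict_mono r" "\<And>k. e \<le> dist (x (r k)) l"
proof -
  obtain e where e: "0 < e" "\<exists>\<^sub>F n in sequentially. e \<le> dist (x n) l"
    using assms by (auto simp: tendsto_iff not_eventually not_less)
  then have "infinite {n. e \<le> dist (x n) l}"
    by (simp add: frequently_cofinite flip: cofinite_eq_sequentially)
  then obtain r :: "nat \<Rightarrow> nat" where "strict_mono r" "\<And>k. r k \<in> {n. e \<le> dist (x n) l}"
    using infinite_enumerate by blast
  with e(1) show thesis using that by blast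
qed

text \<open>\<open>Obs t\<close> is the predual operator whose dual is \<open>Ob t\<close>.\<close>

locale dynamic_radon_problem = dynamic_radon \<Omega> \<Theta> S \<H>
  for \<Omega> \<Theta> :: "(real^'d) set" and S :: "real set" and \<H> :: "(real^'d) measure" +
  fixes T :: "real set" and Obs :: "real \<Rightarrow> 'h::real_inner \<Rightarrow> real^'d \<Rightarrow> real"
    and Ob :: "real \<Rightarrow> (real^'d) measure \<Rightarrow> 'h" and \<alpha> :: real
  assumes T: "finite T" "T \<subseteq> S"
    and Obs: "\<And>t. t \<in> T \<Longrightarrow> bounded_linear_into_C \<Omega> (Obs t)"
    and Ob: "\<And>t. t \<in> T \<Longrightarrow> is_dual_operator \<Omega> (Obs t) (Ob t)"
    and \<alpha>: "0 \<le> \<alpha>"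
begin

section \<open>Continuity of observations and coercivity of the objective\<close>

abbreviation "feas \<equiv> feasible \<Omega> S \<Theta> T \<H> Ob \<alpha>"
abbreviation "obj \<equiv> objective T Ob \<alpha>"
abbreviation "sol \<equiv> is_solution \<Omega> S \<Theta> T \<H> Ob \<alpha>"
abbreviation "cluster \<equiv> cluster_point \<Omega> S \<Theta> T"

text \<open>Pairing an observation with \<open>h\<close> is integrating the continuous function
  \<open>Obs t h\<close>.\<close>

lemma Ob_weakly_continuous:
  assumes "t \<in> T" "\<And>n. \<nu>s n \<in> radon_measures \<Omega>" "\<nu> \<in> radon_measures \<Omega>" "weak_star_tendsto \<Omega> \<nu>s \<nu>"
  shows "(\<lambda>n. Ob t (\<nu>s n) \<bullet> h) \<longlonglongrightarrow> Ob t \<nu> \<bullet> h"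
  using Obs[OF assms(1)] Ob[OF assms(1)] assms(2-)
  by (simp add: bounded_linear_into_C_def is_dual_operator_def weak_star_tendsto_def)

lemma feasible_radon_measures:
  assumes "feas f (u, \<gamma>)"
  shows "t \<in> S \<Longrightarrow> u t \<in> radon_measures \<Omega>" "\<gamma> \<in> radon_measures (\<Theta> \<times> \<Gamma>)"
    "t \<in> S \<Longrightarrow> Mv_bar \<Omega> \<Theta> t \<gamma> = Rd \<Omega> \<Theta> \<H> (u t)"
  using assms by (auto simp: feasible_def)

lemma objective_eq:
  assumes "\<gamma> \<in> radon_measures (\<Theta> \<times> \<Gamma>)"
  shows "obj f (u, \<gamma>) = measure \<gamma> (\<Theta> \<times> \<Gamma>) +
    (if \<alpha> = 0 then 0 else 1 / (2 * \<alpha>) * (\<Sum>t\<in>T. (norm (Ob t (u t) - f t))\<^sup>2))"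
  by (simp add: objective_def total_variation_eq_mass[OF radon_measures_finite[OF assms]]
      space_radon_measures[OF assms])

text \<open>Coercivity: the data term is nonnegative, so a bound on the objective bounds the mass of
  \<open>\<gamma>\<close>.\<close>

lemma measure_le_objective:
  assumes "\<gamma> \<in> radon_measures (\<Theta> \<times> \<Gamma>)"
  shows "measure \<gamma> (\<Theta> \<times> \<Gamma>) \<le> obj f (u, \<gamma>)"
  using \<alpha> by (simp add: objective_eq[OF assms] sum_nonneg)

lemma objective_continuous_in_data:
  assumes "\<forall>t\<in>T. (\<lambda>n. fs n t) \<longlonglongrightarrow> f t"
  shows "(\<lambda>n. obj (fs n) p) \<longlonglongrightarrow> obj f p"
  using assms unfolding objective_def by (cases p) (auto intro!: tendsto_intros)

section \<open>Cluster points: existence, feasibility and lower semicontinuity\<close>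

lemma cluster_point_exists:
  assumes feas: "\<And>n. feas (fs n) (us n, \<gamma>s n)"
    and B: "\<And>n. measure (\<gamma>s n) (\<Theta> \<times> \<Gamma>) \<le> B"
  obtains u \<gamma> where "cluster us \<gamma>s (u, \<gamma>)"
proof -
  note rad = feasible_radon_measures[OF feas]
  have mass: "measure (us n t) \<Omega> \<le> B" if "t \<in> S" for n t
    using B mass_eq_of_constraint[OF that rad(2) rad(1)[OF that] rad(3)[OF that]] by simp
  obtain r1 :: "nat \<Rightarrow> nat" and u1 where r1: "strict_mono r1"
      and u1: "\<And>t. t \<in> T \<Longrightarrow> u1 t \<in> radon_measures \<Omega>"
        "\<And>t. t \<in> T \<Longrightarrow> weak_star_tendsto \<Omega> (\<lambda>k. us (r1 k) t) (u1 t)"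
    using weak_star_subsequence_finite[OF compact_\<Omega> T(1), of us B] rad(1) mass T(2) by (metis subsetD)
  obtain r2 :: "nat \<Rightarrow> nat" and \<gamma> where r2: "strict_mono r2" and \<gamma>: "\<gamma> \<in> radon_measures (\<Theta> \<times> \<Gamma>)"
      "weak_star_tendsto (\<Theta> \<times> \<Gamma>) (\<lambda>k. \<gamma>s (r1 (r2 k))) \<gamma>"
    using weak_star_subsequence[OF compact_product_Gam, of "\<lambda>k. \<gamma>s (r1 k)" B] rad(2) B by blast
  \<comment> \<open>A common subsequence is available for the finitely many measurement times and
    \<open>\<gamma>\<close>. \<open>S\<close> may be uncountable, so every other time gets a further
    subsequence of its own.\<close>
  have "\<exists>s M. strict_mono (s :: nat \<Rightarrow> nat) \<and> M \<in> radon_measures \<Omega> \<and>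
      weak_star_tendsto \<Omega> (\<lambda>k. us (r1 (r2 (s k))) t) M" if "t \<in> S" for t
    using weak_star_subsequence[OF compact_\<Omega>, of "\<lambda>k. us (r1 (r2 k)) t" B] rad(1)[OF that] mass[OF that]
    by metis
  then obtain s u2 where u2: "\<And>t. t \<in> S \<Longrightarrow> strict_mono (s t :: nat \<Rightarrow> nat)"
      "\<And>t. t \<in> S \<Longrightarrow> u2 t \<in> radon_measures \<Omega>"
      "\<And>t. t \<in> S \<Longrightarrow> weak_star_tendsto \<Omega> (\<lambda>k. us (r1 (r2 (s t k))) t) (u2 t)"
    by metis
  \<comment> \<open>At measurement times the limit along the common subsequence is used;
    \<open>restrict\<close> provides the extensionality required of families over
    \<open>S\<close>.\<close>
  define u where "u = restrict (\<lambda>t. if t \<in> T then u1 t else u2 t) S"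
  have uT: "u t = u1 t" if "t \<in> T" for t using that T(2) by (auto simp: u_def)
  have uS: "u t = u2 t" if "t \<in> S - T" for t using that by (auto simp: u_def)
  have "cluster us \<gamma>s (u, \<gamma>)"
    unfolding cluster_point_def prod.case
  proof (intro conjI \<gamma>(1), goal_cases)
    case 2
    show ?case
    proof (rule exI[of _ "r1 \<circ> r2"], intro conjI strict_mono_o r1 r2 ballI)
    show "weak_star_tendsto \<Omega> (\<lambda>k. us ((r1 \<circ> r2) k) t) (u t)" if "t \<in> T" for t
      using weak_star_tendsto_subseq[OF u1(2)[OF that] r2] uT[OF that] by simp
    show "weak_star_tendsto (\<Theta> \<times> \<Gamma>) (\<lambda>k. \<gamma>s ((r1 \<circ> r2) k)) \<gamma>" using \<gamma>(2) by simp
    show "\<exists>s. strict_mono s \<and> weak_star_tendsto \<Omega> (\<lambda>k. us ((r1 \<circ> r2) (s k)) t) (u t)" if "t \<in> S - T" for t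
      using u2(1,3)[of t] uS[OF that] that by auto
    qed
  qed (use u1 u2 in \<open>auto simp: u_def\<close>)
  then show thesis using that by blast
qed

text \<open>The constraint is imposed separately at each time, so it can be passed to the limit
  along a subsequence depending on \<open>t\<close>. For \<open>\<alpha> = 0\<close> the exact fit
  survives because observations converge weakly and data strongly.\<close>

lemma cluster_point_feasible:
  assumes feas: "\<And>n. feas (fs n) (us n, \<gamma>s n)" and fs: "\<forall>t\<in>T. (\<lambda>n. fs n t) \<longlonglongrightarrow> f t"
    and cl: "cluster us \<gamma>s (u, \<gamma>)"
  shows "feas f (u, \<gamma>)"
proof -
  note rad = feasible_radon_measures[OF feas]
  from cl obtain r :: "nat \<Rightarrow> nat" where u: "u \<in> S \<rightarrow>\<^sub>E radon_measures \<Omega>" and \<gamma>: "\<gamma> \<in> radon_measures (\<Theta> \<times> \<Gamma>)"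
      and r: "strict_mono r"
      and uT: "\<And>t. t \<in> T \<Longrightarrow> weak_star_tendsto \<Omega> (\<lambda>k. us (r k) t) (u t)"
      and \<gamma>r: "weak_star_tendsto (\<Theta> \<times> \<Gamma>) (\<lambda>k. \<gamma>s (r k)) \<gamma>"
      and uS: "\<And>t. t \<in> S - T \<Longrightarrow> \<exists>s. strict_mono s \<and> weak_star_tendsto \<Omega> (\<lambda>k. us (r (s k)) t) (u t)"
    unfolding cluster_point_def prod.case by blast
  have ut: "u t \<in> radon_measures \<Omega>" if "t \<in> S" for t using u that by auto
  have "Mv_bar \<Omega> \<Theta> t \<gamma> = Rd \<Omega> \<Theta> \<H> (u t)" if t: "t \<in> S" for t
  proof -
    have "\<exists>s. strict_mono s \<and> weak_star_tendsto \<Omega> (\<lambda>k. us (r (s k)) t) (u t)"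
    proof (cases "t \<in> T")
      case True
      with uT show ?thesis by (intro exI[of _ id]) (simp add: strict_mono_id)
    qed (use uS t in blast)
    then obtain s where s: "strict_mono s" "weak_star_tendsto \<Omega> (\<lambda>k. us (r (s k)) t) (u t)" by blast
    show ?thesis
      by (rule constraint_closed[OF t rad(2) \<gamma> weak_star_tendsto_subseq[OF \<gamma>r s(1)] rad(1)[OF t] ut[OF t] s(2) rad(3)[OF t]])
  qed
  moreover have "Ob t (u t) = f t" if "\<alpha> = 0" and t: "t \<in> T" for t
  proof -
    have tS: "t \<in> S" using t T(2) by blast
    have eq: "Ob t (us n t) = fs n t" for n using feas[of n] that by (simp add: feasible_def)
    have "(\<lambda>k. fs (r k) t \<bullet> h) \<longlonglongrightarrow> Ob t (u t) \<bullet> h" for h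
      using Ob_weakly_continuous[OF t rad(1)[OF tS] ut[OF tS] uT[OF t], of h] by (simp add: eq)
    moreover have "(\<lambda>k. fs (r k) t \<bullet> h) \<longlonglongrightarrow> f t \<bullet> h" for h
      using LIMSEQ_subseq_LIMSEQ[OF fs[rule_format, OF t] r] by (intro tendsto_intros) (simp add: comp_def)
    ultimately have "Ob t (u t) \<bullet> h = f t \<bullet> h" for h by (rule LIMSEQ_unique)
    then show ?thesis using vector_eq_rdot by blast
  qed
  ultimately show ?thesis using u \<gamma> by (simp add: feasible_def)
qed

text \<open>Lower semicontinuity with varying data. The bounds \<open>c n\<close> will be nearly
  minimal values in the existence proof and the values of a competitor in the stability
  proof.\<close>

lemma cluster_point_objective_le:
  assumes feas: "\<And>n. feas (fs n) (us n, \<gamma>s n)" and fs: "\<forall>t\<in>T. (\<lambda>n. fs n t) \<longlonglongrightarrow> f t"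
    and cl: "cluster us \<gamma>s (u, \<gamma>)"
    and c: "\<And>n. obj (fs n) (us n, \<gamma>s n) \<le> c n" "c \<longlonglongrightarrow> c0"
  shows "obj f (u, \<gamma>) \<le> c0"
proof -
  note rad = feasible_radon_measures[OF feas]
  from cl obtain r :: "nat \<Rightarrow> nat" where u: "u \<in> S \<rightarrow>\<^sub>E radon_measures \<Omega>" and \<gamma>: "\<gamma> \<in> radon_measures (\<Theta> \<times> \<Gamma>)"
      and r: "strict_mono r"
      and uT: "\<And>t. t \<in> T \<Longrightarrow> weak_star_tendsto \<Omega> (\<lambda>k. us (r k) t) (u t)"
      and \<gamma>r: "weak_star_tendsto (\<Theta> \<times> \<Gamma>) (\<lambda>k. \<gamma>s (r k)) \<gamma>"
    unfolding cluster_point_def prod.case by blast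
  define v where "v t = Ob t (u t) - f t" for t
  define vs where "vs k t = Ob t (us (r k) t) - fs (r k) t" for k t
  \<comment> \<open>The residuals converge only weakly, which is enough for pairings with the fixed
    limit residual \<open>v t\<close>.\<close>
  have inner: "(\<lambda>k. vs k t \<bullet> v t) \<longlonglongrightarrow> v t \<bullet> v t" if t: "t \<in> T" for t
  proof -
    have tS: "t \<in> S" using t T(2) by blast
    have "(\<lambda>k. Ob t (us (r k) t) \<bullet> v t) \<longlonglongrightarrow> Ob t (u t) \<bullet> v t"
      using u tS by (intro Ob_weakly_continuous[OF t rad(1)[OF tS] _ uT[OF t]]) auto
    moreover have "(\<lambda>k. fs (r k) t \<bullet> v t) \<longlonglongrightarrow> f t \<bullet> v t"
      using LIMSEQ_subseq_LIMSEQ[OF fs[rule_format, OF t] r] by (intro tendsto_intros) (simp add: comp_def)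
    ultimately have "(\<lambda>k. Ob t (us (r k) t) \<bullet> v t - fs (r k) t \<bullet> v t) \<longlonglongrightarrow> Ob t (u t) \<bullet> v t - f t \<bullet> v t"
      by (rule tendsto_diff)
    then show ?thesis by (simp add: vs_def v_def[of t] inner_diff_left)
  qed
  let ?l = "\<lambda>k. measure (\<gamma>s (r k)) (\<Theta> \<times> \<Gamma>) +
    (if \<alpha> = 0 then 0 else 1 / (2 * \<alpha>) * (\<Sum>t\<in>T. 2 * (vs k t \<bullet> v t) - v t \<bullet> v t))"
  have "(\<lambda>k. if \<alpha> = 0 then 0 else 1 / (2 * \<alpha>) * (\<Sum>t\<in>T. 2 * (vs k t \<bullet> v t) - v t \<bullet> v t)) \<longlonglongrightarrow>
      (if \<alpha> = 0 then 0 else 1 / (2 * \<alpha>) * (\<Sum>t\<in>T. 2 * (v t \<bullet> v t) - v t \<bullet> v t))"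
    by (cases "\<alpha> = 0"; simp only: simp_thms if_True if_False) (intro tendsto_intros inner)+
  then have "?l \<longlonglongrightarrow> measure \<gamma> (\<Theta> \<times> \<Gamma>) +
      (if \<alpha> = 0 then 0 else 1 / (2 * \<alpha>) * (\<Sum>t\<in>T. 2 * (v t \<bullet> v t) - v t \<bullet> v t))"
    by (intro tendsto_add weak_star_tendsto_mass[OF rad(2) \<gamma> \<gamma>r])
  \<comment> \<open>The affine minorant is exact at the limit residual, where
    \<open>2 * (v t \<bullet> v t) - v t \<bullet> v t\<close> equals the squared norm.\<close>
  moreover have "obj f (u, \<gamma>) = measure \<gamma> (\<Theta> \<times> \<Gamma>) +
      (if \<alpha> = 0 then 0 else 1 / (2 * \<alpha>) * (\<Sum>t\<in>T. 2 * (v t \<bullet> v t) - v t \<bullet> v t))"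
    by (simp add: objective_eq[OF \<gamma>] v_def power2_norm_eq_inner)
  ultimately have lim: "?l \<longlonglongrightarrow> obj f (u, \<gamma>)" by (simp only:)
  have "?l k \<le> obj (fs (r k)) (us (r k), \<gamma>s (r k))" for k
  proof -
    \<comment> \<open>a lower bound affine in \<open>vs k t\<close>: weak convergence suffices to pass to the limit\<close>
    have "2 * (vs k t \<bullet> v t) - v t \<bullet> v t \<le> (norm (vs k t))\<^sup>2" for t
      using inner_ge_zero[of "vs k t - v t"]
      by (simp add: power2_norm_eq_inner inner_diff_left inner_diff_right inner_commute)
    then have "(\<Sum>t\<in>T. 2 * (vs k t \<bullet> v t) - v t \<bullet> v t) \<le> (\<Sum>t\<in>T. (norm (vs k t))\<^sup>2)"
      by (intro sum_mono)
    with \<alpha> show ?thesis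
      unfolding objective_eq[OF rad(2)] vs_def by (auto intro!: divide_right_mono)
  qed
  then have "?l k \<le> (c \<circ> r) k" for k
    unfolding comp_def by (rule order_trans[OF _ c(1)])
  then show ?thesis
    using LIMSEQ_le[OF lim LIMSEQ_subseq_LIMSEQ[OF c(2) r]] by blast
qed

section \<open>Existence of minimizers\<close>

lemma feasible_nonempty:
  assumes "\<alpha> = 0 \<Longrightarrow> \<exists>m\<in>radon_measures (Lam \<Omega> S). \<forall>t\<in>T. Ob t (Mv \<Omega> t m) = f t"
  obtains p where "feas f p"
proof -
  \<comment> \<open>For \<open>\<alpha> > 0\<close> the observations are unconstrained and the zero
    measure can be lifted; for \<open>\<alpha> = 0\<close> the assumed \<open>m\<close> is lifted
    instead.\<close>
  have "null_measure (restrict_space borel (Lam \<Omega> S)) \<in> radon_measures (Lam \<Omega> S)"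
    by (simp add: radon_measures_compact[OF compact_Lam] finite_measureI)
  with assms obtain m where m: "m \<in> radon_measures (Lam \<Omega> S)" "\<alpha> = 0 \<Longrightarrow> \<forall>t\<in>T. Ob t (Mv \<Omega> t m) = f t"
    by metis
  obtain \<gamma> where "\<gamma> \<in> radon_measures (\<Theta> \<times> \<Gamma>)"
    "\<And>t. t \<in> S \<Longrightarrow> Mv \<Omega> t m \<in> radon_measures \<Omega>"
    "\<And>t. t \<in> S \<Longrightarrow> Mv_bar \<Omega> \<Theta> t \<gamma> = Rd \<Omega> \<Theta> \<H> (Mv \<Omega> t m)"
    using lift_radon_measure[OF m(1)] by blast
  with m(2) T(2) have "feas f (restrict (\<lambda>t. Mv \<Omega> t m) S, \<gamma>)"
    by (auto simp: feasible_def)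
  then show thesis using that by blast
qed

lemma solution_iff: "sol f p \<longleftrightarrow> feas f p \<and> (\<forall>q. feas f q \<longrightarrow> obj f p \<le> obj f q)"
  by (auto simp: is_solution_def is_arg_min_def not_less)

lemma solution_exists:
  assumes "\<alpha> = 0 \<Longrightarrow> \<exists>m\<in>radon_measures (Lam \<Omega> S). \<forall>t\<in>T. Ob t (Mv \<Omega> t m) = f t"
  shows "\<exists>u \<gamma>. sol f (u, \<gamma>)"
proof -
  let ?V = "obj f ` Collect (feas f)"
  have ne: "?V \<noteq> {}" using feasible_nonempty[OF assms] by blast
  have nonneg: "0 \<le> obj f p" if "feas f p" for p
    using that measure_le_objective[of "snd p" f "fst p"] feasible_radon_measures(2)[of f "fst p" "snd p"]
    by (simp add: order_trans[OF measure_nonneg])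
  have bdd: "bdd_below ?V" by (rule bdd_belowI[of _ 0]) (use nonneg in blast)
  \<comment> \<open>A minimizing sequence; \<open>Suc n\<close> keeps the tolerance in
    \<open>(0, 1]\<close>, which yields the uniform bound \<open>Inf ?V + 1\<close>.\<close>
  have "\<exists>u \<gamma>. feas f (u, \<gamma>) \<and> obj f (u, \<gamma>) \<le> Inf ?V + 1 / real (Suc n)" for n
    using cInf_lessD[OF ne, of "Inf ?V + 1 / real (Suc n)"] by (force intro: less_imp_le)
  then obtain us \<gamma>s where feas: "\<And>n. feas f (us n, \<gamma>s n)"
      and le: "\<And>n. obj f (us n, \<gamma>s n) \<le> Inf ?V + 1 / real (Suc n)"
    by metis
  have bound: "measure (\<gamma>s n) (\<Theta> \<times> \<Gamma>) \<le> Inf ?V + 1" for n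
  proof -
    have "1 / real (Suc n) \<le> 1" by simp
    with le[of n] measure_le_objective[OF feasible_radon_measures(2)[OF feas[of n]], of f "us n"]
    show ?thesis by linarith
  qed
  \<comment> \<open>The cluster point lemmas allow varying data and are used here with the constant
    data sequence \<open>\<lambda>_. f\<close>.\<close>
  obtain u \<gamma> where cl: "cluster us \<gamma>s (u, \<gamma>)"
    by (rule cluster_point_exists[of "\<lambda>_. f" us \<gamma>s "Inf ?V + 1"]) (rule feas bound | assumption)+
  have "(\<lambda>n. Inf ?V + 1 / real (Suc n)) \<longlonglongrightarrow> Inf ?V + 0"
    by (intro tendsto_intros LIMSEQ_Suc[OF lim_1_over_n])
  then have "obj f (u, \<gamma>) \<le> Inf ?V"
    using cluster_point_objective_le[of "\<lambda>_. f" us \<gamma>s f u \<gamma>, OF feas _ cl le] by simp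
  moreover have "feas f (u, \<gamma>)"
    using cluster_point_feasible[of "\<lambda>_. f" us \<gamma>s f, OF feas _ cl] by simp
  moreover have "Inf ?V \<le> obj f q" if "feas f q" for q
    using that bdd by (intro cInf_lower) auto
  ultimately show ?thesis unfolding solution_iff by (meson order_trans)
qed

section \<open>Stability with respect to the data\<close>

lemma feasible_data_irrelevant: "\<alpha> > 0 \<Longrightarrow> feas f p \<longleftrightarrow> feas g p"
  by (auto simp: feasible_def)

text \<open>For \<open>\<alpha> > 0\<close> one point \<open>q\<close> is feasible for all data at
  once. Minimality bounds the objectives of the solutions by those of \<open>q\<close>, which
  converge and are therefore bounded.\<close>

lemma solutions_bounded:
  assumes pos: "\<alpha> > 0" and fs: "\<forall>t\<in>T. (\<lambda>n. fs n t) \<longlonglongrightarrow> f t" and sol: "\<And>n. sol (fs n) (us n, \<gamma>s n)"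
  obtains B where "\<And>n. measure (\<gamma>s n) (\<Theta> \<times> \<Gamma>) \<le> B"
proof -
  obtain q where q: "feas f q" using feasible_nonempty[of f] pos by auto
  have "Bseq (\<lambda>n. obj (fs n) q)"
    by (intro convergent_imp_Bseq convergentI[OF objective_continuous_in_data[OF fs]])
  then obtain B where B: "\<And>n. norm (obj (fs n) q) \<le> B" by (auto simp: Bseq_def)
  have "measure (\<gamma>s n) (\<Theta> \<times> \<Gamma>) \<le> B" for n
  proof -
    have feas: "feas (fs n) (us n, \<gamma>s n)" using sol[of n] by (simp add: solution_iff)
    have "feas (fs n) q" using q feasible_data_irrelevant[OF pos] by blast
    then have "obj (fs n) (us n, \<gamma>s n) \<le> obj (fs n) q" using sol[of n] unfolding solution_iff by blast
    also have "\<dots> \<le> B" using B[of n] by simp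
    finally show ?thesis
      using measure_le_objective[OF feasible_radon_measures(2)[OF feas], of "fs n" "us n"] by linarith
  qed
  then show thesis using that by blast
qed

lemma solutions_cluster_point_exists:
  assumes "\<alpha> > 0" "\<forall>t\<in>T. (\<lambda>n. fs n t) \<longlonglongrightarrow> f t" "\<And>n. sol (fs n) (us n, \<gamma>s n)"
  obtains u \<gamma> where "cluster us \<gamma>s (u, \<gamma>)"
proof -
  obtain B where "\<And>n. measure (\<gamma>s n) (\<Theta> \<times> \<Gamma>) \<le> B" using solutions_bounded[OF assms] by blast
  then show thesis
    using cluster_point_exists[of fs us \<gamma>s B] assms(3) that by (auto simp: solution_iff)
qed

text \<open>Any competitor \<open>q\<close> for \<open>f\<close> also competes for each
  \<open>fs n\<close>; the inequality of minimality passes to the limit by lower semicontinuity on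
  the left and continuity in the data on the right.\<close>

lemma cluster_point_solution:
  assumes pos: "\<alpha> > 0" and fs: "\<forall>t\<in>T. (\<lambda>n. fs n t) \<longlonglongrightarrow> f t" and sol: "\<And>n. sol (fs n) (us n, \<gamma>s n)"
    and cl: "cluster us \<gamma>s (u, \<gamma>)"
  shows "sol f (u, \<gamma>)"
proof -
  have feas: "feas (fs n) (us n, \<gamma>s n)" for n using sol by (simp add: solution_iff)
  have "obj f (u, \<gamma>) \<le> obj f q" if "feas f q" for q
  proof (rule cluster_point_objective_le[OF feas fs cl _ objective_continuous_in_data[OF fs]])
    fix n
    have "feas (fs n) q" using that feasible_data_irrelevant[OF pos] by blast
    then show "obj (fs n) (us n, \<gamma>s n) \<le> obj (fs n) q" using sol[of n] unfolding solution_iff by blast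
  qed
  then show ?thesis using cluster_point_feasible[OF feas fs cl] by (simp add: solution_iff)
qed

text \<open>Subsequence principle: if some integral stayed away from its limit along a subsequence,
  a cluster point of that subsequence would contradict uniqueness. Convergence is tested for one
  \<open>t\<close> at a time, so subsequences depending on \<open>t\<close> suffice.\<close>

lemma solutions_tendsto_of_unique:
  assumes pos: "\<alpha> > 0" and fs: "\<forall>t\<in>T. (\<lambda>n. fs n t) \<longlonglongrightarrow> f t" and sol: "\<And>n. sol (fs n) (us n, \<gamma>s n)"
    and uniq: "\<And>p. sol f p \<Longrightarrow> p = (u, \<gamma>)"
  shows "\<forall>t\<in>S. weak_star_tendsto \<Omega> (\<lambda>n. us n t) (u t)" "weak_star_tendsto (\<Theta> \<times> \<Gamma>) \<gamma>s \<gamma>"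
proof -
  \<comment> \<open>A subsequence of the solutions consists of solutions for the corresponding
    subsequence of data, so it has a cluster point, and this can only be
    \<open>(u, \<gamma>)\<close>.\<close>
  have sub: "\<exists>s. strict_mono s \<and> (\<forall>t\<in>T. weak_star_tendsto \<Omega> (\<lambda>k. us (r (s k)) t) (u t)) \<and>
      weak_star_tendsto (\<Theta> \<times> \<Gamma>) (\<lambda>k. \<gamma>s (r (s k))) \<gamma> \<and>
      (\<forall>t\<in>S - T. \<exists>s'. strict_mono s' \<and> weak_star_tendsto \<Omega> (\<lambda>k. us (r (s (s' k))) t) (u t))"
    if r: "strict_mono (r :: nat \<Rightarrow> nat)" for r
  proof -
    have fs': "\<forall>t\<in>T. (\<lambda>n. fs (r n) t) \<longlonglongrightarrow> f t"
      using LIMSEQ_subseq_LIMSEQ[OF _ r] fs by (force simp: comp_def)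
    obtain v \<delta> where cl: "cluster (\<lambda>n. us (r n)) (\<lambda>n. \<gamma>s (r n)) (v, \<delta>)"
      using solutions_cluster_point_exists[OF pos fs' sol] by blast
    then have "(v, \<delta>) = (u, \<gamma>)" by (intro uniq cluster_point_solution[OF pos fs' sol])
    with cl show ?thesis unfolding cluster_point_def prod.case by blast
  qed
  show "weak_star_tendsto (\<Theta> \<times> \<Gamma>) \<gamma>s \<gamma>"
    unfolding weak_star_tendsto_def
  proof (intro allI impI, rule ccontr)
    fix \<phi> :: "(real^'d) \<times> real \<times> real \<Rightarrow> real" assume \<phi>: "continuous_on (\<Theta> \<times> \<Gamma>) \<phi>"
    assume "\<not> (\<lambda>n. integral\<^sup>L (\<gamma>s n) \<phi>) \<longlonglongrightarrow> integral\<^sup>L \<gamma> \<phi>"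
    then obtain e and r :: "nat \<Rightarrow> nat" where e: "0 < e" and r: "strict_mono r"
        and far: "\<And>k. e \<le> dist (integral\<^sup>L (\<gamma>s (r k)) \<phi>) (integral\<^sup>L \<gamma> \<phi>)"
      by (rule not_tendsto_subseq) blast
    from sub[OF r] \<phi> obtain s where "(\<lambda>k. integral\<^sup>L (\<gamma>s (r (s k))) \<phi>) \<longlonglongrightarrow> integral\<^sup>L \<gamma> \<phi>"
      unfolding weak_star_tendsto_def by blast
    from tendstoD[OF this e] show False
      using far by (auto simp: eventually_sequentially not_less[symmetric])
  qed
  show "\<forall>t\<in>S. weak_star_tendsto \<Omega> (\<lambda>n. us n t) (u t)"
    unfolding weak_star_tendsto_def
  proof (intro allI impI ballI, rule ccontr)
    fix t and \<phi> :: "real^'d \<Rightarrow> real" assume t: "t \<in> S" and \<phi>: "continuous_on \<Omega> \<phi>"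
    assume "\<not> (\<lambda>n. integral\<^sup>L (us n t) \<phi>) \<longlonglongrightarrow> integral\<^sup>L (u t) \<phi>"
    then obtain e and r :: "nat \<Rightarrow> nat" where e: "0 < e" and r: "strict_mono r"
        and far: "\<And>k. e \<le> dist (integral\<^sup>L (us (r k) t) \<phi>) (integral\<^sup>L (u t) \<phi>)"
      by (rule not_tendsto_subseq) blast
    have "\<exists>s. (\<lambda>k. integral\<^sup>L (us (r (s k)) t) \<phi>) \<longlonglongrightarrow> integral\<^sup>L (u t) \<phi>"
    proof (cases "t \<in> T")
      case True
      with sub[OF r] \<phi> show ?thesis unfolding weak_star_tendsto_def by blast
    next
      case False
      with sub[OF r] \<phi> t show ?thesis unfolding weak_star_tendsto_def by (metis DiffI)
    qed
    then obtain s where "(\<lambda>k. integral\<^sup>L (us (r (s k)) t) \<phi>) \<longlonglongrightarrow> integral\<^sup>L (u t) \<phi>" by blast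
    from tendstoD[OF this e] show False
      using far by (auto simp: eventually_sequentially not_less[symmetric])
  qed
qed

end

section \<open>Existence and stability combined\<close>

theorem proposition38:
  fixes \<Omega> \<Theta> :: "(real^'d) set" and S T :: "real set"
    and \<H> :: "(real^'d) measure"
    and Obs :: "real \<Rightarrow> 'h::{real_inner, complete_space} \<Rightarrow> real^'d \<Rightarrow> real"
    and Ob :: "real \<Rightarrow> (real^'d) measure \<Rightarrow> 'h"
    and f :: "real \<Rightarrow> 'h" and \<alpha> :: real
  assumes "compact \<Omega>" and "compact S" and "compact \<Theta>" and "\<Theta> \<subseteq> sphere 0 1"
    and "T \<noteq> {}" and "finite T" and "T \<subseteq> S"
    and "compact (Lam \<Omega> S)"
    and "sets \<H> = sets (restrict_space borel \<Theta>)" and "prob_space \<H>" and "measure_support \<H> = \<Theta>"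
    and "\<And>t. t \<in> T \<Longrightarrow> bounded_linear_into_C \<Omega> (Obs t)"
    and "\<And>t. t \<in> T \<Longrightarrow> is_dual_operator \<Omega> (Obs t) (Ob t)"
    and "\<alpha> \<ge> 0"
    and "\<alpha> = 0 \<Longrightarrow> \<exists>m\<in>radon_measures (Lam \<Omega> S). \<forall>t\<in>T. Ob t (Mv \<Omega> t m) = f t"
  shows "(\<exists>u \<gamma>. is_solution \<Omega> S \<Theta> T \<H> Ob \<alpha> f (u, \<gamma>)) \<and>
    (\<alpha> > 0 \<longrightarrow>
      (\<forall>fs us \<gamma>s.
        (\<forall>t\<in>T. (\<lambda>n. fs n t) \<longlonglongrightarrow> f t) \<longrightarrow>
        (\<forall>n. is_solution \<Omega> S \<Theta> T \<H> Ob \<alpha> (fs n) (us n, \<gamma>s n)) \<longrightarrow>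
        (\<exists>u \<gamma>. cluster_point \<Omega> S \<Theta> T us \<gamma>s (u, \<gamma>)) \<and>
        (\<forall>u \<gamma>. cluster_point \<Omega> S \<Theta> T us \<gamma>s (u, \<gamma>) \<longrightarrow>
           is_solution \<Omega> S \<Theta> T \<H> Ob \<alpha> f (u, \<gamma>)) \<and>
        (\<forall>u \<gamma>. is_solution \<Omega> S \<Theta> T \<H> Ob \<alpha> f (u, \<gamma>) \<and>
           (\<forall>p. is_solution \<Omega> S \<Theta> T \<H> Ob \<alpha> f p \<longrightarrow> p = (u, \<gamma>)) \<longrightarrow>
           (\<forall>t\<in>S. weak_star_tendsto \<Omega> (\<lambda>n. us n t) (u t)) \<and>
           weak_star_tendsto (\<Theta> \<times> Gam \<Omega> S \<Theta>) \<gamma>s \<gamma>)))"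
proof -
  interpret dynamic_radon_problem \<Omega> \<Theta> S \<H> T Obs Ob \<alpha>
    by (intro dynamic_radon_problem.intro dynamic_radon.intro dynamic_radon_problem_axioms.intro) (fact assms)+
  show ?thesis
  proof (intro conjI impI allI)
    show "\<exists>u \<gamma>. sol f (u, \<gamma>)"
      by (rule solution_exists) (rule assms)
  next
    fix fs us \<gamma>s
    assume pos: "\<alpha> > 0" and fs: "\<forall>t\<in>T. (\<lambda>n. fs n t) \<longlonglongrightarrow> f t" and sol: "\<forall>n. sol (fs n) (us n, \<gamma>s n)"
    note sol = sol[rule_format]
    show "\<exists>u \<gamma>. cluster us \<gamma>s (u, \<gamma>)"
      using solutions_cluster_point_exists[OF pos fs sol] by metis
    show "sol f (u, \<gamma>)" if "cluster us \<gamma>s (u, \<gamma>)" for u \<gamma>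
      by (rule cluster_point_solution[OF pos fs sol that])
    fix u \<gamma> assume "sol f (u, \<gamma>) \<and> (\<forall>p. sol f p \<longrightarrow> p = (u, \<gamma>))"
    then have uniq: "p = (u, \<gamma>)" if "sol f p" for p using that by blast
    show "\<forall>t\<in>S. weak_star_tendsto \<Omega> (\<lambda>n. us n t) (u t)" "weak_star_tendsto (\<Theta> \<times> \<Gamma>) \<gamma>s \<gamma>"
      using solutions_tendsto_of_unique[OF pos fs sol uniq] by blast+
  qed
qed


end
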